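(* The abstract problem with neutral acoustic boundary conditions $$\left\{\begin{array}{ll}\ddot u(t)=Au(t), & t\in\mathbb{R},\\ \ddot x(t)=B_1^\diamond u(t)+B_2^\diamond\dot u(t)+B_3^\diamond x(t)+B_4^\diamond\dot x(t), & t\in\mathbb{R},\\ \dot x(t)=Lu(t), & t\in\mathbb{R},\\ u(0)=f,\quad\dot u(0)=g,\\ x(0)=h,\quad \dot x(0)=j,\end{array}\right.$$ on $X$ and $\partial X$ is well-posed.
   Context: Assumptions: $X$, $Y$, $\partial X$ are Banach spaces ($\partial X$ is just the name of a third Banach space) with $Y\hookrightarrow X$ continuously. $A:D(A)\to X$ is linear with $D(A)\subset Y$. $R:D(A)\to\partial X$ is linear, $B_1,B_2\in\mathcal{L}(Y,\partial X)$, $B_3,B_4\in\mathcal{L}(\partial X)$, and $L:=R+B_2:D(A)\to\partial X$. The operator $\binom{A}{R}:D(A)\subset Y\to X\times\partial X$, $u\mapsto (Au,Ru)$, is closed. The operator $M:D(M)\subset\partial X\to\partial X$ is linear and closed with $1\in\rho(M)$, and $R(1,M)=(I-M)^{-1}$. Set $B_i^\diamond:=R(1,M)B_i$ for $i=1,2,3,4$ and $R^\diamond:=L-B_2^\diamond$. It is assumed that $R^\diamond:D(A)\to\partial X$ is surjective and that $A_0^\diamond:=A|_{\ker R^\diamond}$ generates a cosine operator function with associated phase space $Y\times X$ (i.e. $\begin{pmatrix} 0 & I_Y \\ A_0^\diamond & 0 \end{pmatrix}$ with domain $D(A_0^\diamond)\times Y$ generates a strongly continuous group on $Y\times X$). A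 classical solution on $(Y,X,\partial X)$ is a function $u\in C^2(\mathbb{R},X)\cap C^1(\mathbb{R},Y)$ with $Lu\in C^1(\mathbb{R},\partial X)$ and $u(t)\in D(A)$ for all $t\in\mathbb{R}$ which, together with $x(t)=h+\int_0^tLu(s)\,ds$, satisfies the problem pointwise. Well-posedness means: for all $f\in D(A)$, $g\in Y$, $h\in\partial X$, $j=Lf$ there is a unique classical solution; the set of such $(f,g,h,j)$ is dense in $Y\times X\times\partial X\times\partial X$; and $(u,\dot u,x,\dot x)$ depends continuously on $(f,g,h,j)$ in the norm of $Y\times X\times\partial X\times\partial X$, uniformly on compact time intervals. *)

theory Defs
  imports "HOL-Analysis.Analysis"
begin

text \<open>An unbounded operator is a domain \<open>D\<close> together with a total function whose values outside
  \<open>D\<close> are irrelevant.\<close>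

definition linear_operator :: "'a::real_vector set \<Rightarrow> ('a \<Rightarrow> 'b::real_vector) \<Rightarrow> bool"
  where "linear_operator D T \<longleftrightarrow> subspace D \<and>
    (\<forall>u\<in>D. \<forall>v\<in>D. T (u + v) = T u + T v) \<and> (\<forall>c. \<forall>u\<in>D. T (c *\<^sub>R u) = c *\<^sub>R T u)"

definition operator_graph :: "'a set \<Rightarrow> ('a \<Rightarrow> 'b) \<Rightarrow> ('a \<times> 'b) set"
  where "operator_graph D T = (\<lambda>u. (u, T u)) ` D"

definition closed_operator ::
    "'a::real_normed_vector set \<Rightarrow> ('a \<Rightarrow> 'b::real_normed_vector) \<Rightarrow> bool"
  where "closed_operator D T \<longleftrightarrow> closed (operator_graph D T)"

definition resolvent :: "'a::real_normed_vector set \<Rightarrow> ('a \<Rightarrow> 'a) \<Rightarrow> real \<Rightarrow> 'a \<Rightarrow> 'a"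
  where "resolvent D M l = inv_into D (\<lambda>x. l *\<^sub>R x - M x)"

definition resolvent_set :: "'a::real_normed_vector set \<Rightarrow> ('a \<Rightarrow> 'a) \<Rightarrow> real set"
  where "resolvent_set D M =
    {l. bij_betw (\<lambda>x. l *\<^sub>R x - M x) D UNIV \<and> bounded_linear (resolvent D M l)}"

definition strongly_continuous_group :: "(real \<Rightarrow> 'a::real_normed_vector \<Rightarrow> 'a) \<Rightarrow> bool"
  where "strongly_continuous_group T \<longleftrightarrow>
    (\<forall>t. bounded_linear (T t)) \<and> T 0 = id \<and> (\<forall>s t. T (s + t) = T s \<circ> T t) \<and>
    (\<forall>x. continuous_on UNIV (\<lambda>t. T t x))"

definition generates_group :: "'a::real_normed_vector set \<Rightarrow> ('a \<Rightarrow> 'a) \<Rightarrow> bool"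
  where "generates_group D G \<longleftrightarrow>
    (\<exists>T. strongly_continuous_group T \<and>
      {(x, y). ((\<lambda>t. T t x) has_vector_derivative y) (at 0)} = operator_graph D G)"

text \<open>The continuous inclusion of \<open>Y\<close> into \<open>X\<close> is an injective bounded linear map \<open>\<iota>\<close>. The operator
  \<open>A\<^sub>0\<close> with domain \<open>D\<^sub>0\<close> in \<open>Y\<close> generates a cosine operator function with phase space
  \<open>Y \<times> X\<close> iff the matrix with rows \<open>(0, I\<^sub>Y)\<close>, \<open>(A\<^sub>0, 0)\<close> and domain \<open>D\<^sub>0 \<times> Y\<close> generates a
  group on \<open>Y \<times> X\<close>. The copy of \<open>Y\<close> in the second factor is \<open>range \<iota>\<close>.\<close>

definition generates_cosine_with_phase_space ::
    "('y::banach \<Rightarrow> 'x::banach) \<Rightarrow> 'y set \<Rightarrow> ('y \<Rightarrow> 'x) \<Rightarrow> bool"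
  where "generates_cosine_with_phase_space \<iota> D0 A0 \<longleftrightarrow>
    generates_group (D0 \<times> range \<iota>) (\<lambda>(u, v). (inv \<iota> v, A0 u))"

definition C2_on_line :: "(real \<Rightarrow> 'a::real_normed_vector) \<Rightarrow> bool"
  where "C2_on_line u \<longleftrightarrow> u C1_differentiable_on UNIV \<and>
    (\<lambda>t. vector_derivative u (at t)) C1_differentiable_on UNIV"

text \<open>The integral over \<open>{a..b}\<close> vanishes for \<open>a > b\<close>, so negative times need the second term.\<close>

definition oriented_integral :: "real \<Rightarrow> real \<Rightarrow> (real \<Rightarrow> 'a::banach) \<Rightarrow> 'a"
  where "oriented_integral a b w = integral {a..b} w - integral {b..a} w"

definition boundary_component :: "('y \<Rightarrow> 'b::banach) \<Rightarrow> (real \<Rightarrow> 'y) \<Rightarrow> 'b \<Rightarrow> real \<Rightarrow> 'b"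
  where "boundary_component L u h t = h + oriented_integral 0 t (\<lambda>s. L (u s))"

text \<open>A solution takes values in \<open>D \<subseteq> Y\<close>, so it is a \<open>Y\<close>-valued function and \<open>\<iota> \<circ> u\<close> is the same
  function with values in \<open>X\<close>. Below, \<open>C1\<close> to \<open>C4\<close> are the operators acting on
  \<open>u, du/dt, x, dx/dt\<close> in the boundary equation.\<close>

definition classical_solution ::
    "('y::banach \<Rightarrow> 'x::banach) \<Rightarrow> 'y set \<Rightarrow> ('y \<Rightarrow> 'x) \<Rightarrow> ('y \<Rightarrow> 'b::banach) \<Rightarrow>
     ('y \<Rightarrow> 'b) \<Rightarrow> ('y \<Rightarrow> 'b) \<Rightarrow> ('b \<Rightarrow> 'b) \<Rightarrow> ('b \<Rightarrow> 'b) \<Rightarrow>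
     'y \<Rightarrow> 'y \<Rightarrow> 'b \<Rightarrow> 'b \<Rightarrow> (real \<Rightarrow> 'y) \<Rightarrow> bool"
  where "classical_solution \<iota> D A L C1 C2 C3 C4 f g h j u \<longleftrightarrow>
    (let u' = (\<lambda>t. vector_derivative u (at t));
         x = boundary_component L u h;
         x' = (\<lambda>t. vector_derivative x (at t))
     in C2_on_line (\<iota> \<circ> u) \<and> u C1_differentiable_on UNIV \<and>
        (\<lambda>t. L (u t)) C1_differentiable_on UNIV \<and> (\<forall>t. u t \<in> D) \<and>
        (\<forall>t. ((\<lambda>s. vector_derivative (\<iota> \<circ> u) (at s)) has_vector_derivative A (u t)) (at t)) \<and>
        (\<forall>t. (x' has_vector_derivative C1 (u t) + C2 (u' t) + C3 (x t) + C4 (x' t)) (at t)) \<and>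
        (\<forall>t. (x has_vector_derivative L (u t)) (at t)) \<and>
        u 0 = f \<and> u' 0 = g \<and> x 0 = h \<and> x' 0 = j)"

definition solution_state ::
    "('y::banach \<Rightarrow> 'x::banach) \<Rightarrow> ('y \<Rightarrow> 'b::banach) \<Rightarrow> 'b \<Rightarrow> (real \<Rightarrow> 'y) \<Rightarrow>
     real \<Rightarrow> 'y \<times> 'x \<times> 'b \<times> 'b"
  where "solution_state \<iota> L h u t =
    (u t, \<iota> (vector_derivative u (at t)),
     boundary_component L u h t, vector_derivative (boundary_component L u h) (at t))"

definition well_posed ::
    "('y::banach \<Rightarrow> 'x::banach) \<Rightarrow> 'y set \<Rightarrow> ('y \<Rightarrow> 'x) \<Rightarrow> ('y \<Rightarrow> 'b::banach) \<Rightarrow>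
     ('y \<Rightarrow> 'b) \<Rightarrow> ('y \<Rightarrow> 'b) \<Rightarrow> ('b \<Rightarrow> 'b) \<Rightarrow> ('b \<Rightarrow> 'b) \<Rightarrow> bool"
  where "well_posed \<iota> D A L C1 C2 C3 C4 \<longleftrightarrow>
    (\<forall>f\<in>D. \<forall>g h. \<exists>!u. classical_solution \<iota> D A L C1 C2 C3 C4 f g h (L f) u) \<and>
    closure {(f, \<iota> g, h :: 'b, L f) | f g h. f \<in> D} = UNIV \<and>
    (\<forall>a b. \<forall>f\<in>D. \<forall>g h u. classical_solution \<iota> D A L C1 C2 C3 C4 f g h (L f) u \<longrightarrow>
      (\<forall>\<epsilon>>0. \<exists>\<delta>>0. \<forall>f2\<in>D. \<forall>g2 h2 u2.
        classical_solution \<iota> D A L C1 C2 C3 C4 f2 g2 h2 (L f2) u2 \<longrightarrow>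
        dist (f2, \<iota> g2, h2, L f2) (f, \<iota> g, h, L f) < \<delta> \<longrightarrow>
        (\<forall>t\<in>{a..b}. dist (solution_state \<iota> L h2 u2 t) (solution_state \<iota> L h u t) < \<epsilon>)))"

end

theory Submission
  imports Defs
begin

text \<open>
  Write \<open>v = du/dt\<close> and \<open>y = dx/dt\<close>. The problem is then the first order equation
  \<open>(u, v, x, y)' = (v, A u, y, B1d u + B2d v + B3d x + B4d y)\<close> on \<open>Y \<times> X \<times> \<partial>X \<times> \<partial>X\<close>, and the whole
  difficulty is the coupling \<open>y = L u\<close>, which belongs to the domain of the operator matrix. The proof
  shows that this matrix generates a strongly continuous group; existence, uniqueness, density and
  continuous dependence are then general properties of groups and their generators.

  Two changes of variables turn the matrix into a bounded perturbation of the wave operator with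
  homogeneous boundary condition. The first replaces \<open>y\<close> by \<open>w = y - B2d u\<close>. It rewrites the coupling
  as \<open>Rd u = w\<close> and, because \<open>dw/dt = B1d u + B3d x + B4d y\<close>, it removes the velocity \<open>v\<close> from the
  boundary equation: \<open>B2d\<close> is bounded on \<open>Y\<close> but \<open>v\<close> is controlled only in \<open>X\<close>, so this is the one term
  that is not bounded on the state space. The second change of variables replaces \<open>u\<close> by
  \<open>u0 = u - E w\<close>, where the Dirichlet operator \<open>E\<close> solves \<open>A (E w) = \<kappa> (E w)\<close>, \<open>Rd (E w) = w\<close>. Now
  \<open>u0\<close> lies in the kernel of \<open>Rd\<close>, the domain decouples, and
  \<open>(u0, v, x, w)' = (v, A u0, 0, 0) + bounded terms\<close>.

  The generator of a group has large real \<open>\<mu>\<close> in its resolvent set, so \<open>\<kappa> = \<mu>\<^sup>2\<close> is in the resolvent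
  set of the restriction of \<open>A\<close> to the kernel of \<open>Rd\<close>; together with the surjectivity of \<open>Rd\<close> this gives
  \<open>E\<close>, and the closed graph theorem shows that \<open>E\<close> is bounded.

  Besides the closed graph theorem and the uniform boundedness principle, the argument rests on the
  bounded perturbation theorem for groups. For a group \<open>T\<close> with generator \<open>G\<close>, put
  \<open>z(t) = T(t) y(t)\<close>. Then \<open>z' = (G + P) z\<close> becomes \<open>y' = T(-t) P T(t) y\<close>, a linear equation with bounded,
  strongly continuous coefficients, which Picard iteration solves.
\<close>

section \<open>Consequences of the Baire category theorem\<close>

text \<open>Zabreiko's lemma. By Baire, the closure of some sublevel set of \<open>p\<close> contains a ball, and
  differences of its points fill a ball around the origin. So every point of that ball is the limit of
  points with bounded \<open>p\<close>. Approximating the remainder again and again, at half the scale each time,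
  writes the point as a series along which \<open>p\<close> decays geometrically, and countable subadditivity bounds
  \<open>p\<close> at the point itself. Both the uniform boundedness principle and the closed graph theorem are
  instances.\<close>

lemma countably_subadditive_seminorm_bounded:
  fixes p :: "'a::banach \<Rightarrow> real"
  assumes scale: "\<And>c x. p (c *\<^sub>R x) = \<bar>c\<bar> * p x"
    and add: "\<And>x y. p (x + y) \<le> p x + p y"
    and csub: "\<And>f x. f sums x \<Longrightarrow> summable (\<lambda>n. p (f n)) \<Longrightarrow> p x \<le> (\<Sum>n. p (f n))"
  shows "\<exists>K\<ge>0. \<forall>x. p x \<le> K * norm x"
proof -
  have p0: "p 0 = 0" using scale[of 0 0] by simp
  have pm: "p (- x) = p x" for x using scale[of "-1" x] by simp
  have pos: "0 \<le> p x" for x using add[of x "-x"] p0 pm by simp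
  define C where "C n = closure {x. p x \<le> real n}" for n
  have "\<exists>n. interior (C n) \<noteq> {}"
  proof (rule ccontr)
    assume "\<not> ?thesis"
    then have "Met_TC.mtopology interior_of (\<Union>(range C)) = {}"
      by (intro Met_TC.metric_Baire_category_alt) (auto simp: C_def complete_UNIV)
    then have "interior (\<Union>(range C)) = {}"
      by simp
    moreover have "\<Union>(range C) = UNIV"
    proof -
      have "x \<in> C (nat \<lceil>p x\<rceil>)" for x
        unfolding C_def by (rule subsetD[OF closure_subset]) (simp add: real_nat_ceiling_ge)
      then show ?thesis by blast
    qed
    ultimately show False by simp
  qed
  then obtain n a where "a \<in> interior (C n)" by blast
  then obtain r where r: "r > 0" "ball a r \<subseteq> C n"
    by (meson mem_interior)
  define N where "N = 2 * real n"
  \<comment> \<open>A ball around \<open>a\<close> is moved to the origin by taking differences, at the cost of a factor two.\<close>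
  have near: "\<exists>z. p z \<le> N \<and> norm (x - z) < e" if "norm x < r" "e > 0" for x e
  proof -
    have "a + x \<in> C n" "a \<in> C n" using r that by (auto simp: dist_norm)
    then obtain z1 z2 where z: "p z1 \<le> n" "dist z1 (a + x) < e/2" "p z2 \<le> n" "dist z2 a < e/2"
      unfolding C_def closure_approachable using half_gt_zero[OF \<open>e > 0\<close>] by fast
    have "p (z1 - z2) \<le> N" using add[of z1 "-z2"] z pm[of z2] by (simp add: N_def)
    moreover have "norm (x - (z1 - z2)) < e"
      using z(2,4) norm_triangle_ineq4[of "z2 - a" "z1 - (a + x)"]
      by (simp add: dist_norm algebra_simps)
    ultimately show ?thesis by blast
  qed
  have step: "\<exists>z. p z \<le> N * c \<and> norm (x - z) < r * (c / 2)" if "norm x < r * c" "c > 0" for x c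
  proof -
    have "norm (x /\<^sub>R c) < r" using that by (simp add: field_simps)
    then obtain z where z: "p z \<le> N" "norm (x /\<^sub>R c - z) < r / 2"
      using near[of "x /\<^sub>R c" "r/2"] r(1) by auto
    have "x - c *\<^sub>R z = c *\<^sub>R (x /\<^sub>R c - z)" using that by (simp add: algebra_simps)
    then have "norm (x - c *\<^sub>R z) = c * norm (x /\<^sub>R c - z)" using that by simp
    also have "\<dots> < r * (c / 2)" using z(2) that by (simp add: field_simps)
    finally have "norm (x - c *\<^sub>R z) < r * (c / 2)" .
    moreover have "p (c *\<^sub>R z) \<le> N * c" using z(1) that by (simp add: scale)
    ultimately show ?thesis by blast
  qed
  then obtain Z where Z: "\<And>x c. norm x < r * c \<Longrightarrow> c > 0 \<Longrightarrow>
      p (Z x c) \<le> N * c \<and> norm (x - Z x c) < r * (c / 2)"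
    by metis
  have small: "p x \<le> 2 * N" if x: "norm x < r" for x
  proof -
    define res where "res = rec_nat x (\<lambda>k y. y - Z y ((1/2)^k))"
    have res0: "res 0 = x" and resS: "res (Suc k) = res k - Z (res k) ((1/2)^k)" for k
      by (simp_all add: res_def)
    have bd: "norm (res k) < r * (1/2)^k" for k
    proof (induction k)
      case 0 then show ?case using x res0 by simp
    next
      case (Suc k)
      then show ?case using Z[OF Suc] resS[of k] by simp
    qed
    have "(\<lambda>k. r * (1/2)^k) \<longlonglongrightarrow> r * 0"
      by (intro tendsto_intros LIMSEQ_power_zero) auto
    then have "(\<lambda>k. r * (1/2)^k) \<longlonglongrightarrow> 0" by simp
    then have "res \<longlonglongrightarrow> 0"
      by (rule Lim_null_comparison[rotated]) (intro always_eventually allI less_imp_le bd)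
    from telescope_sums'[OF this] have s: "(\<lambda>k. Z (res k) ((1/2)^k)) sums x"
      by (simp add: res0 resS)
    have le: "p (Z (res k) ((1/2)^k)) \<le> N * (1/2)^k" for k
      using Z[OF bd] by simp
    have geo: "(\<lambda>k. N * (1/2)^k) sums (N * 2)"
      using sums_mult[OF geometric_sums[of "1/2::real"], of N] by simp
    have sm: "summable (\<lambda>k. p (Z (res k) ((1/2)^k)))"
      by (rule summable_comparison_test'[OF sums_summable[OF geo]]) (use le pos in auto)
    have "p x \<le> (\<Sum>k. p (Z (res k) ((1/2)^k)))" by (rule csub[OF s sm])
    also have "\<dots> \<le> N * 2" using suminf_le[OF le sm sums_summable[OF geo]] sums_unique[OF geo] by simp
    finally show ?thesis by simp
  qed
  have "p x \<le> 4 * N / r * norm x" for x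
  proof (cases "x = 0")
    case True then show ?thesis by (simp add: p0)
  next
    case False
    \<comment> \<open>Rescale \<open>x\<close> to half the radius, strictly inside the ball.\<close>
    have "p ((r / (2 * norm x)) *\<^sub>R x) \<le> 2 * N"
      by (rule small) (use False r(1) in simp)
    then show ?thesis using False r(1) by (simp add: scale field_simps)
  qed
  moreover have "4 * N / r \<ge> 0" using r(1) by (simp add: N_def)
  ultimately show ?thesis by blast
qed

text \<open>The seminorm \<open>p x = (SUP i. norm (T i x))\<close> is countably subadditive since each \<open>T i\<close> is
  continuous.\<close>

theorem uniform_boundedness_principle:
  fixes T :: "'i \<Rightarrow> 'a::banach \<Rightarrow> 'b::banach"
  assumes lin: "\<And>i. i \<in> I \<Longrightarrow> bounded_linear (T i)"
    and bdd: "\<And>x. bdd_above ((\<lambda>i. norm (T i x)) ` I)"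
  shows "\<exists>K\<ge>0. \<forall>i\<in>I. \<forall>x. norm (T i x) \<le> K * norm x"
proof (cases "I = {}")
  case False
  define p where "p x = (SUP i\<in>I. norm (T i x))" for x
  have upper: "norm (T i x) \<le> p x" if "i \<in> I" for i x
    unfolding p_def by (rule cSUP_upper[OF that bdd])
  have least: "p x \<le> b" if "\<And>i. i \<in> I \<Longrightarrow> norm (T i x) \<le> b" for x b
    unfolding p_def using False that by (intro cSUP_least) auto
  have "\<exists>K\<ge>0. \<forall>x. p x \<le> K * norm x"
  proof (rule countably_subadditive_seminorm_bounded)
    have le: "p (c *\<^sub>R x) \<le> \<bar>c\<bar> * p x" for c x
      using upper lin by (intro least) (auto simp: linear_simps mult_left_mono)
    show "p (c *\<^sub>R x) = \<bar>c\<bar> * p x" for c x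
    proof (cases "c = 0")
      case True
      obtain i where "i \<in> I" using False by blast
      then have "0 \<le> p 0" using upper[of i 0] norm_ge_zero order_trans by blast
      then show ?thesis using True le[of 0 x] by simp
    next
      case c: False
      have "p x \<le> \<bar>inverse c\<bar> * p (c *\<^sub>R x)" using le[of "inverse c" "c *\<^sub>R x"] c by simp
      then show ?thesis using le[of c x] c by (simp add: field_simps abs_mult)
    qed
    show "p (x + y) \<le> p x + p y" for x y
    proof (rule least)
      fix i assume "i \<in> I"
      then show "norm (T i (x + y)) \<le> p x + p y"
        using norm_triangle_mono[OF upper upper, of i i x y] lin[of i] by (simp add: linear_simps)
    qed
    show "p x \<le> (\<Sum>n. p (f n))" if f: "f sums x" "summable (\<lambda>n. p (f n))" for f x
    proof (rule least)
      fix i assume i: "i \<in> I"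
      have sm: "summable (\<lambda>n. norm (T i (f n)))"
        by (rule summable_comparison_test'[OF f(2)]) (use upper[OF i] in auto)
      have "(\<lambda>n. T i (f n)) sums T i x" by (rule bounded_linear.sums[OF lin[OF i] f(1)])
      then have "norm (T i x) \<le> (\<Sum>n. norm (T i (f n)))"
        using summable_norm[OF sm] by (simp add: sums_iff)
      also have "\<dots> \<le> (\<Sum>n. p (f n))"
        by (rule suminf_le[OF upper[OF i] sm f(2)])
      finally show "norm (T i x) \<le> (\<Sum>n. p (f n))" .
    qed
  qed
  then show ?thesis using upper by (meson order_trans)
qed auto

text \<open>The seminorm \<open>norm (T x)\<close> is countably subadditive: if \<open>\<Sum>norm (T (f n))\<close> is finite then
  \<open>\<Sum>T (f n)\<close> converges, and closedness of the graph identifies its limit as \<open>T (\<Sum>f n)\<close>.\<close>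

theorem closed_graph_theorem:
  fixes T :: "'a::banach \<Rightarrow> 'b::banach"
  assumes lin: "linear T"
    and closed: "\<And>f x y. f \<longlonglongrightarrow> x \<Longrightarrow> (\<lambda>n. T (f n)) \<longlonglongrightarrow> y \<Longrightarrow> T x = y"
  shows "bounded_linear T"
proof -
  have "\<exists>K\<ge>0. \<forall>x. norm (T x) \<le> K * norm x"
  proof (rule countably_subadditive_seminorm_bounded)
    show "norm (T (c *\<^sub>R x)) = \<bar>c\<bar> * norm (T x)" for c x
      using lin by (simp add: linear_scale)
    show "norm (T (x + y)) \<le> norm (T x) + norm (T y)" for x y
      using lin by (simp add: linear_add norm_triangle_ineq)
    show "norm (T x) \<le> (\<Sum>n. norm (T (f n)))"
      if f: "f sums x" "summable (\<lambda>n. norm (T (f n)))" for f x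
    proof -
      have "summable (\<lambda>n. T (f n))" by (rule summable_norm_cancel[OF f(2)])
      then have "(\<lambda>n. T (\<Sum>i<n. f i)) \<longlonglongrightarrow> (\<Sum>n. T (f n))"
        using lin by (simp add: linear_sum summable_LIMSEQ)
      then have "T x = (\<Sum>n. T (f n))"
        using f(1) closed unfolding sums_def by blast
      then show ?thesis using summable_norm[OF f(2)] by simp
    qed
  qed
  then show ?thesis
    using lin by (auto simp: bounded_linear_def bounded_linear_axioms_def mult.commute)
qed

section \<open>Linear differential equations with strongly continuous coefficients\<close>

definition strongly_continuous_family ::
    "(real \<Rightarrow> 'a::real_normed_vector \<Rightarrow> 'b::real_normed_vector) \<Rightarrow> bool"
  where "strongly_continuous_family F \<longleftrightarrow>
    (\<forall>t. bounded_linear (F t)) \<and> (\<forall>x. continuous_on UNIV (\<lambda>t. F t x))"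

lemma strongly_continuous_family_bounded_on_compact:
  fixes F :: "real \<Rightarrow> 'a::banach \<Rightarrow> 'b::banach"
  assumes F: "strongly_continuous_family F"
  obtains K where "K \<ge> 0" "\<And>t x. \<bar>t\<bar> \<le> a \<Longrightarrow> norm (F t x) \<le> K * norm x"
proof -
  have "bdd_above ((\<lambda>t. norm (F t x)) ` {-a..a})" for x
  proof -
    have "continuous_on {-a..a} (\<lambda>t. norm (F t x))"
      using F unfolding strongly_continuous_family_def
      by (intro continuous_on_norm) (blast intro: continuous_on_subset)
    then have "compact ((\<lambda>t. norm (F t x)) ` {-a..a})"
      by (intro compact_continuous_image) auto
    then show ?thesis by (intro bounded_imp_bdd_above compact_imp_bounded)
  qed
  with F have "\<exists>K\<ge>0. \<forall>t\<in>{-a..a}. \<forall>x. norm (F t x) \<le> K * norm x"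
    by (intro uniform_boundedness_principle) (auto simp: strongly_continuous_family_def)
  then obtain K where "K \<ge> 0" "\<And>t x. t \<in> {-a..a} \<Longrightarrow> norm (F t x) \<le> K * norm x" by blast
  then show ?thesis by (intro that[of K]) (auto simp: abs_le_iff)
qed

text \<open>Strong continuity is separate continuity of \<open>(t, x) \<mapsto> F t x\<close>; local boundedness, from the uniform
  boundedness principle, makes it joint continuity.\<close>

lemma strongly_continuous_family_tendsto:
  fixes F :: "real \<Rightarrow> 'a::banach \<Rightarrow> 'b::banach"
  assumes F: "strongly_continuous_family F"
    and s: "(s \<longlongrightarrow> s0) \<FF>" and c: "(c \<longlongrightarrow> c0) \<FF>"
  shows "((\<lambda>i. F (s i) (c i)) \<longlongrightarrow> F s0 c0) \<FF>"
proof -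
  obtain K where K: "K \<ge> 0" "\<And>t x. \<bar>t\<bar> \<le> \<bar>s0\<bar> + 1 \<Longrightarrow> norm (F t x) \<le> K * norm x"
    using strongly_continuous_family_bounded_on_compact[OF F] by blast
  have lin: "bounded_linear (F t)" for t using F by (simp add: strongly_continuous_family_def)
  have "\<forall>\<^sub>F i in \<FF>. dist (s i) s0 < 1" using s by (rule tendstoD) simp
  then have ev: "\<forall>\<^sub>F i in \<FF>. norm (F (s i) (c i - c0)) \<le> K * norm (c i - c0)"
    by eventually_elim (auto intro!: K(2) simp: dist_real_def)
  have "((\<lambda>i. K * norm (c i - c0)) \<longlongrightarrow> K * norm (c0 - c0)) \<FF>"
    by (intro tendsto_intros c)
  then have 1: "((\<lambda>i. F (s i) (c i - c0)) \<longlongrightarrow> 0) \<FF>"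
    using Lim_null_comparison[OF ev] by simp
  have "isCont (\<lambda>t. F t c0) s0"
    using F by (simp add: strongly_continuous_family_def continuous_on_eq_continuous_at)
  then have 2: "((\<lambda>i. F (s i) c0) \<longlongrightarrow> F s0 c0) \<FF>"
    by (rule isCont_tendsto_compose[OF _ s])
  show ?thesis
    using tendsto_add[OF 1 2] by (simp add: linear_simps(2)[OF lin])
qed

lemma strongly_continuous_family_continuous_on:
  fixes F :: "real \<Rightarrow> 'a::banach \<Rightarrow> 'b::banach"
  assumes "strongly_continuous_family F" "continuous_on S s" "continuous_on S c"
  shows "continuous_on S (\<lambda>t. F (s t) (c t))"
  using assms strongly_continuous_family_tendsto unfolding continuous_on_def by blast

lemma oriented_integral_has_vector_derivative:
  assumes f: "continuous_on UNIV f"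
  shows "((\<lambda>t. oriented_integral a t f) has_vector_derivative f t) (at t)"
proof -
  \<comment> \<open>The base point \<open>c\<close> lies to the left of both \<open>a\<close> and \<open>t\<close>, so that only unoriented integrals occur near \<open>t\<close>.\<close>
  define c d where "c = min a t - 1" and "d = max a t + 1"
  have cont: "continuous_on {p..q} f" for p q using f by (rule continuous_on_subset) simp
  have "((\<lambda>s. integral {c..s} f - integral {c..a} f) has_vector_derivative f t - 0) (at t within {c..d})"
    by (intro has_vector_derivative_diff integral_has_vector_derivative cont has_vector_derivative_const)
      (auto simp: c_def d_def)
  then have "((\<lambda>s. oriented_integral a s f) has_vector_derivative f t) (at t within {c..d})"
  proof (rule has_vector_derivative_transform[rotated 2, OF has_vector_derivative_eq_rhs])
    show "t \<in> {c..d}" by (auto simp: c_def d_def)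
    fix s assume s: "s \<in> {c..d}"
    have "c \<le> a" "c \<le> s" using s by (auto simp: c_def)
    then show "oriented_integral a s f = integral {c..s} f - integral {c..a} f"
      using Henstock_Kurzweil_Integration.integral_combine[where a=c and c=a and b=s and f=f] Henstock_Kurzweil_Integration.integral_combine[where a=c and c=s and b=a and f=f]
        integrable_continuous_real[OF cont] 
      by (cases a s rule: linorder_cases) (auto simp: oriented_integral_def algebra_simps add_eq_0_iff
          dest!: sym[where t = "integral _ _"])
  qed auto
  moreover have "at t within {c..d} = at t"
    by (rule at_within_interior) (auto simp: c_def d_def)
  ultimately show ?thesis by simp
qed

lemma oriented_integral_eq_antiderivative:
  assumes "continuous_on UNIV f" "\<And>t. (F has_vector_derivative f t) (at t)"
  shows "F t = F a + oriented_integral a t f"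
proof -
  obtain c where c: "\<And>s. s \<in> UNIV \<Longrightarrow> F s - oriented_integral a s f = c"
    by (rule has_vector_derivative_zero_constant[of UNIV "\<lambda>s. F s - oriented_integral a s f"])
      (auto intro!: derivative_eq_intros assms oriented_integral_has_vector_derivative)
  have "F t - oriented_integral a t f = F a - oriented_integral a a f"
    using c by simp
  then show ?thesis by (simp add: oriented_integral_def algebra_simps)
qed

text \<open>One step of Picard iteration multiplies by \<open>K\<close> and integrates, and so turns the \<open>n\<close>-th term of the
  series of \<open>C * exp (K * \<bar>t\<bar>)\<close> into the next one. The same estimate serves for the convergence of the
  iteration and for uniqueness.\<close>

lemma norm_le_exponential_term_integral_nonneg:
  fixes F :: "real \<Rightarrow> 'a::real_normed_vector"
  assumes F: "\<And>s. \<bar>s\<bar> \<le> a \<Longrightarrow> (F has_vector_derivative f s) (at s)" "F 0 = 0"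
    and f: "\<And>s. \<bar>s\<bar> \<le> a \<Longrightarrow> norm (f s) \<le> K * (C * ((K * \<bar>s\<bar>) ^ n / fact n))"
    and t: "0 \<le> t" "t \<le> a"
  shows "norm (F t) \<le> C * ((K * t) ^ Suc n / fact (Suc n))"
proof (cases "t = 0")
  case False
  have d: "((\<lambda>s. C * ((K * s) ^ Suc n / fact (Suc n))) has_vector_derivative
      K * (C * ((K * s) ^ n / fact n))) (at s)" for s :: real
    unfolding has_real_derivative_iff_has_vector_derivative[symmetric]
    by (rule derivative_eq_intros refl | simp add: field_simps del: of_nat_Suc)+
  have "norm (F t - F 0) \<le> C * ((K * t) ^ Suc n / fact (Suc n)) - C * ((K * 0) ^ Suc n / fact (Suc n))"
  proof (rule differentiable_bound_general)
    show "0 < t" using t False by simp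
    show "continuous_on {0..t} F"
      using F(1) t by (intro continuous_at_imp_continuous_on ballI)
        (rule has_vector_derivative_continuous[OF F(1)], auto)
    show "continuous_on {0..t} (\<lambda>s. C * ((K * s) ^ Suc n / fact (Suc n)))"
      by (intro continuous_intros) simp
    show "(F has_vector_derivative f s) (at s)" if "0 < s" "s < t" for s
      using F(1) t that by simp
    show "norm (f s) \<le> K * (C * ((K * s) ^ n / fact n))" if "0 < s" "s < t" for s
      using f[of s] t that by simp
  qed (rule d)
  then show ?thesis using F(2) by simp
qed (use F in simp)

lemma norm_le_exponential_term_integral:
  fixes F :: "real \<Rightarrow> 'a::real_normed_vector"
  assumes F: "\<And>s. \<bar>s\<bar> \<le> a \<Longrightarrow> (F has_vector_derivative f s) (at s)" "F 0 = 0"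
    and f: "\<And>s. \<bar>s\<bar> \<le> a \<Longrightarrow> norm (f s) \<le> K * (C * ((K * \<bar>s\<bar>) ^ n / fact n))"
    and t: "\<bar>t\<bar> \<le> a"
  shows "norm (F t) \<le> C * ((K * \<bar>t\<bar>) ^ Suc n / fact (Suc n))"
proof (cases "t \<ge> 0")
  case True
  then show ?thesis using norm_le_exponential_term_integral_nonneg[OF F f] t by simp
next
  case False
  have d: "((\<lambda>s. F (- s)) has_vector_derivative - f (- s)) (at s)" if "\<bar>s\<bar> \<le> a" for s
  proof -
    have "((F \<circ> uminus) has_vector_derivative (-1) *\<^sub>R f (- s)) (at s)"
      by (rule vector_diff_chain_at) (use F(1)[of "-s"] that in \<open>auto intro!: derivative_eq_intros\<close>)
    then show ?thesis by (simp add: o_def)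
  qed
  have "norm (F (- (- t))) \<le> C * ((K * (- t)) ^ Suc n / fact (Suc n))"
  proof (rule norm_le_exponential_term_integral_nonneg[OF d])
    show "norm (- f (- s)) \<le> K * (C * ((K * \<bar>s\<bar>) ^ n / fact n))" if "\<bar>s\<bar> \<le> a" for s
      using f[of "- s"] that by simp
  qed (use F t False in auto)
  then show ?thesis using False by simp
qed

text \<open>The difference \<open>d\<close> of two solutions is bounded on a compact interval, and integrating \<open>d' = Q d\<close>
  repeatedly bounds it by \<open>m * (K * \<bar>t\<bar>) ^ n / fact n\<close> for every \<open>n\<close>, which tends to zero.\<close>

lemma linear_ode_unique:
  fixes Q :: "real \<Rightarrow> 'a::banach \<Rightarrow> 'a"
  assumes Q: "strongly_continuous_family Q"
    and y: "\<And>t. (y has_vector_derivative Q t (y t)) (at t)"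
    and z: "\<And>t. (z has_vector_derivative Q t (z t)) (at t)"
    and eq: "y 0 = z 0"
  shows "y = z"
proof
  fix t
  have lin: "bounded_linear (Q t)" for t using Q by (simp add: strongly_continuous_family_def)
  define d where "d s = y s - z s" for s
  have d: "(d has_vector_derivative Q s (d s)) (at s)" for s
    unfolding d_def linear_simps(2)[OF lin] by (intro has_vector_derivative_diff y z)
  obtain K where K: "K \<ge> 0" "\<And>s x. \<bar>s\<bar> \<le> \<bar>t\<bar> \<Longrightarrow> norm (Q s x) \<le> K * norm x"
    using strongly_continuous_family_bounded_on_compact[OF Q] by blast
  have "continuous_on {-\<bar>t\<bar>..\<bar>t\<bar>} d"
    using d by (meson continuous_at_imp_continuous_on has_vector_derivative_continuous)
  then have "bounded (d ` {-\<bar>t\<bar>..\<bar>t\<bar>})"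
    by (intro compact_imp_bounded compact_continuous_image) auto
  then obtain m where m: "\<And>s. \<bar>s\<bar> \<le> \<bar>t\<bar> \<Longrightarrow> norm (d s) \<le> m"
    unfolding bounded_iff by (force simp: abs_le_iff)
  have it: "norm (d s) \<le> m * ((K * \<bar>s\<bar>) ^ n / fact n)" if "\<bar>s\<bar> \<le> \<bar>t\<bar>" for s n
    using that
  proof (induction n arbitrary: s)
    case 0 then show ?case using m by simp
  next
    case (Suc n)
    show ?case
    proof (rule norm_le_exponential_term_integral[OF d _ _ Suc.prems])
      show "d 0 = 0" by (simp add: d_def eq)
      show "norm (Q r (d r)) \<le> K * (m * ((K * \<bar>r\<bar>) ^ n / fact n))" if "\<bar>r\<bar> \<le> \<bar>t\<bar>" for r
        using K(2)[OF that] mult_left_mono[OF Suc.IH[OF that] K(1)] by (rule order_trans)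
    qed
  qed
  have "(\<lambda>n. (K * \<bar>t\<bar>) ^ n / fact n) \<longlonglongrightarrow> 0"
    using summable_LIMSEQ_zero[OF summable_exp[of "K * \<bar>t\<bar>"]]
    by (simp add: divide_inverse mult.commute)
  then have "(\<lambda>n. m * ((K * \<bar>t\<bar>) ^ n / fact n)) \<longlonglongrightarrow> m * 0"
    by (rule tendsto_mult_left)
  then have "norm (d t) \<le> m * 0"
    by (rule LIMSEQ_le_const) (use it in auto)
  then show "y t = z t" by (simp add: d_def)
qed

text \<open>The solution is the sum of the Picard increments \<open>Y n\<close>. On each interval around the origin the series
  and its derivative converge uniformly, dominated by the exponential series, which is also the
  source of the final bound. That bound makes the solution depend boundedly on \<open>x\<close>.\<close>

lemma linear_ode_solvable:
  fixes Q :: "real \<Rightarrow> 'a::banach \<Rightarrow> 'a"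
  assumes Q: "strongly_continuous_family Q"
  obtains y where "y 0 = x" "\<And>t. (y has_vector_derivative Q t (y t)) (at t)"
    "\<And>a K t. K \<ge> 0 \<Longrightarrow> (\<And>s v. \<bar>s\<bar> \<le> a \<Longrightarrow> norm (Q s v) \<le> K * norm v) \<Longrightarrow> \<bar>t\<bar> \<le> a \<Longrightarrow>
      norm (y t) \<le> exp (K * \<bar>t\<bar>) * norm x"
proof -
  have lin: "bounded_linear (Q t)" for t using Q by (simp add: strongly_continuous_family_def)
  define Y where "Y = rec_nat (\<lambda>t. x) (\<lambda>n Yn t. oriented_integral 0 t (\<lambda>s. Q s (Yn s)))"
  have Y0: "Y 0 = (\<lambda>t. x)" and YS: "Y (Suc n) = (\<lambda>t. oriented_integral 0 t (\<lambda>s. Q s (Y n s)))" for n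
    by (simp_all add: Y_def)
  have Yc: "continuous_on UNIV (Y n)" for n
  proof (induction n)
    case (Suc n)
    then have "continuous_on UNIV (\<lambda>s. Q s (Y n s))"
      by (intro strongly_continuous_family_continuous_on[OF Q] continuous_on_id)
    then show ?case unfolding YS
      by (intro continuous_at_imp_continuous_on ballI)
        (blast intro: has_vector_derivative_continuous oriented_integral_has_vector_derivative)
  qed (simp add: Y0)
  have QYc: "continuous_on UNIV (\<lambda>s. Q s (Y n s))" for n
    by (intro strongly_continuous_family_continuous_on[OF Q] continuous_on_id Yc)
  have Yd: "(Y (Suc n) has_vector_derivative Q t (Y n t)) (at t)" for n t
    unfolding YS by (rule oriented_integral_has_vector_derivative[OF QYc])
  have YS0: "Y (Suc n) 0 = 0" for n by (simp add: YS oriented_integral_def)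
  have Yb: "norm (Y n t) \<le> norm x * ((K * \<bar>t\<bar>) ^ n / fact n)"
    if K: "K \<ge> 0" "\<And>s v. \<bar>s\<bar> \<le> a \<Longrightarrow> norm (Q s v) \<le> K * norm v" and t: "\<bar>t\<bar> \<le> a" for K a n t
    using t
  proof (induction n arbitrary: t)
    case (Suc n)
    show ?case
    proof (rule norm_le_exponential_term_integral[OF Yd _ _ Suc.prems])
      show "norm (Q r (Y n r)) \<le> K * (norm x * ((K * \<bar>r\<bar>) ^ n / fact n))" if "\<bar>r\<bar> \<le> a" for r
        using K(2)[OF that] mult_left_mono[OF Suc.IH[OF that] K(1)] by (rule order_trans)
    qed (rule YS0)
  qed (simp add: Y0)
  define y where "y t = (\<Sum>n. Y n t)" for t
  have exps: "(\<lambda>n. norm x * (c ^ n / fact n)) sums (norm x * exp c)" for c :: real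
    using sums_mult[OF exp_converges[of c], of "norm x"] by (simp add: divide_inverse mult.commute)
  have sm: "summable (\<lambda>n. norm (Y n t))" for t
  proof -
    obtain K where K: "K \<ge> 0" "\<And>s v. \<bar>s\<bar> \<le> \<bar>t\<bar> \<Longrightarrow> norm (Q s v) \<le> K * norm v"
      using strongly_continuous_family_bounded_on_compact[OF Q] by blast
    show ?thesis
      by (rule summable_comparison_test'[OF sums_summable[OF exps]]) (use Yb[OF K] in auto)
  qed
  have ysums: "(\<lambda>n. Y n t) sums y t" for t
    unfolding y_def by (rule summable_sums[OF summable_norm_cancel[OF sm]])
  have "y 0 = x"
  proof -
    have "(\<lambda>n. Y n 0) sums Y 0 0"
      by (rule sums_If_finite_set[of "{0}", THEN sums_cong[THEN iffD1, rotated], simplified])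
        (metis YS0 not0_implies_Suc)
    then show ?thesis using ysums sums_unique2 Y0 by metis
  qed
  moreover have "(y has_vector_derivative Q t (y t)) (at t)" for t
  proof -
    define a where "a = \<bar>t\<bar> + 1"
    obtain K where K: "K \<ge> 0" "\<And>s v. \<bar>s\<bar> \<le> a \<Longrightarrow> norm (Q s v) \<le> K * norm v"
      using strongly_continuous_family_bounded_on_compact[OF Q] by blast
    \<comment> \<open>The derivative of \<open>Y n\<close>: the increments are shifted by one and the first is constant.\<close>
    define f' where "f' n s = (case n of 0 \<Rightarrow> 0 | Suc m \<Rightarrow> Q s (Y m s))" for n s
    have f's: "(\<lambda>n. f' n s) sums Q s (y s)" for s
    proof -
      have "(\<lambda>n. f' (Suc n) s) sums Q s (y s)"
        unfolding f'_def using bounded_linear.sums[OF lin ysums] by simp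
      then show ?thesis by (subst (asm) sums_Suc_iff) (simp add: f'_def)
    qed
    have f'b: "norm (f' (Suc n) s) \<le> K * (norm x * ((K * a) ^ n / fact n))" if "s \<in> ball 0 a" for n s
    proof -
      have s: "\<bar>s\<bar> \<le> a" using that by simp
      have "norm (f' (Suc n) s) \<le> K * norm (Y n s)" using K(2)[OF s] by (simp add: f'_def)
      also have "\<dots> \<le> K * (norm x * ((K * \<bar>s\<bar>) ^ n / fact n))"
        by (intro mult_left_mono[OF Yb[OF K s] K(1)])
      also have "\<dots> \<le> K * (norm x * ((K * a) ^ n / fact n))"
        using K(1) s by (intro mult_left_mono divide_right_mono power_mono) auto
      finally show ?thesis .
    qed
    have "uniform_limit (ball 0 a) (\<lambda>n s. \<Sum>i<n. f' i s) (\<lambda>s. \<Sum>i. f' i s) sequentially"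
    proof (rule Weierstrass_m_test)
      show "norm (f' n s) \<le> (case n of 0 \<Rightarrow> 0 | Suc m \<Rightarrow> K * (norm x * ((K * a) ^ m / fact m)))"
        if "s \<in> ball 0 a" for n s
        using f'b[OF that] by (cases n) (auto simp: f'_def)
      show "summable (\<lambda>n. case n of 0 \<Rightarrow> 0 | Suc m \<Rightarrow> K * (norm x * ((K * a) ^ m / fact m)))"
        by (subst summable_Suc_iff[symmetric]) (simp only: nat.case summable_mult[OF sums_summable[OF exps]])
    qed
    then have ul: "uniform_limit (ball 0 a) (\<lambda>n s. \<Sum>i<n. f' i s) (\<lambda>s. Q s (y s)) sequentially"
      using f's by (simp add: sums_iff)
    have "\<exists>g. \<forall>s\<in>ball 0 a. (\<lambda>n. Y n s) sums g s \<and>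
        (g has_derivative (\<lambda>h. h *\<^sub>R Q s (y s))) (at s within ball 0 a)"
    proof (rule has_derivative_series[OF convex_ball, where f' = "\<lambda>n s h. h *\<^sub>R f' n s"])
      show "(Y n has_derivative (\<lambda>h. h *\<^sub>R f' n s)) (at s within ball 0 a)" for n s
        unfolding has_vector_derivative_def[symmetric] f'_def
        by (cases n) (auto simp: Y0 intro: has_vector_derivative_at_within Yd)
      show "\<forall>\<^sub>F n in sequentially. \<forall>s\<in>ball 0 a. \<forall>h.
          norm ((\<Sum>i<n. h *\<^sub>R f' i s) - h *\<^sub>R Q s (y s)) \<le> e * norm h" if "e > 0" for e
        using uniform_limitD[OF ul that]
        by eventually_elim
          (simp add: dist_norm scaleR_sum_right[symmetric] scaleR_diff_right[symmetric]
            mult.commute[of e] mult_left_mono less_imp_le)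
      show "0 \<in> ball 0 a" by (simp add: a_def)
      show "(\<lambda>n. Y n 0) sums y 0" by (rule ysums)
    qed
    then obtain g where g: "\<And>s. s \<in> ball 0 a \<Longrightarrow> (\<lambda>n. Y n s) sums g s"
        "\<And>s. s \<in> ball 0 a \<Longrightarrow> (g has_vector_derivative Q s (y s)) (at s within ball 0 a)"
      unfolding has_vector_derivative_def by blast
    have t: "t \<in> ball 0 a" by (simp add: a_def)
    have "(y has_vector_derivative Q t (y t)) (at t within ball 0 a)"
      by (rule has_vector_derivative_transform[OF t _ g(2)[OF t]]) (use g(1) ysums sums_unique2 in blast)
    then show ?thesis using at_within_open[OF t open_ball] by simp
  qed
  moreover have "norm (y t) \<le> exp (K * \<bar>t\<bar>) * norm x"
    if K: "K \<ge> 0" "\<And>s v. \<bar>s\<bar> \<le> a \<Longrightarrow> norm (Q s v) \<le> K * norm v" "\<bar>t\<bar> \<le> a" for a K t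
  proof -
    have "norm (y t) \<le> (\<Sum>n. norm (Y n t))" unfolding y_def by (rule summable_norm[OF sm])
    also have "\<dots> \<le> (\<Sum>n. norm x * ((K * \<bar>t\<bar>) ^ n / fact n))"
      by (rule suminf_le[OF Yb[OF K] sm sums_summable[OF exps]])
    also have "\<dots> = exp (K * \<bar>t\<bar>) * norm x"
      using sums_unique[OF exps[of "K * \<bar>t\<bar>"]] by (simp add: mult.commute)
    finally show ?thesis .
  qed
  ultimately show ?thesis by (rule that)
qed

section \<open>Strongly continuous groups and their generators\<close>

definition infinitesimal_generator :: "(real \<Rightarrow> 'a::real_normed_vector \<Rightarrow> 'a) \<Rightarrow> ('a \<times> 'a) set"
  where "infinitesimal_generator T = {(x, y). ((\<lambda>t. T t x) has_vector_derivative y) (at 0)}"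

lemma generates_group_iff:
  "generates_group D G \<longleftrightarrow>
    (\<exists>T. strongly_continuous_group T \<and> infinitesimal_generator T = operator_graph D G)"
  by (simp add: generates_group_def infinitesimal_generator_def)

lemma has_vector_derivative_iff_quotient:
  "(f has_vector_derivative D) (at t) \<longleftrightarrow> ((\<lambda>s. (f s - f t) /\<^sub>R (s - t)) \<longlongrightarrow> D) (at t)"
proof -
  have "norm (f s - f t - (s - t) *\<^sub>R D) / norm (s - t) = norm ((f s - f t) /\<^sub>R (s - t) - D)"
    if "s \<noteq> t" for s
  proof -
    have "(f s - f t) /\<^sub>R (s - t) - D = (f s - f t - (s - t) *\<^sub>R D) /\<^sub>R (s - t)"
      using that by (simp add: scaleR_diff_right)
    then show ?thesis by (simp add: divide_inverse mult.commute)
  qed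
  then have "((\<lambda>s. norm (f s - f t - (s - t) *\<^sub>R D) / norm (s - t)) \<longlongrightarrow> 0) (at t) \<longleftrightarrow>
      ((\<lambda>s. norm ((f s - f t) /\<^sub>R (s - t) - D)) \<longlongrightarrow> 0) (at t)"
    by (intro Lim_cong_within) auto
  then have "(f has_vector_derivative D) (at t) \<longleftrightarrow>
      ((\<lambda>s. norm ((f s - f t) /\<^sub>R (s - t) - D)) \<longlongrightarrow> 0) (at t)"
    unfolding has_vector_derivative_def has_derivative_iff_norm
    by (simp only: bounded_linear_scaleR_left simp_thms)
  also have "\<dots> \<longleftrightarrow> ((\<lambda>s. (f s - f t) /\<^sub>R (s - t)) \<longlongrightarrow> D) (at t)"
    by (simp add: tendsto_norm_zero_iff LIM_zero_iff)
  finally show ?thesis .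
qed

context
  fixes T :: "real \<Rightarrow> 'a::banach \<Rightarrow> 'a"
  assumes T: "strongly_continuous_group T"
begin

lemma group_bounded_linear: "bounded_linear (T t)"
  and group_zero [simp]: "T 0 x = x"
  and group_add: "T (s + t) x = T s (T t x)"
  and group_strongly_continuous_family: "strongly_continuous_family T"
  using T by (simp_all add: strongly_continuous_group_def strongly_continuous_family_def)

lemma group_cancel [simp]: "T (- t) (T t x) = x" "T t (T (- t) x) = x"
  using group_add[of "- t" t x] group_add[of t "- t" x] by simp_all

lemma group_commute: "T s (T t x) = T t (T s x)"
  by (simp only: group_add[symmetric] add.commute)

lemma infinitesimal_generator_shift:
  assumes "(x, y) \<in> infinitesimal_generator T"
  shows "((\<lambda>s. T (s - t) x) has_vector_derivative y) (at t)"
proof -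
  have "(((\<lambda>s. T s x) \<circ> (\<lambda>s. s - t)) has_vector_derivative 1 *\<^sub>R y) (at t)"
    by (rule vector_diff_chain_at)
      (use assms in \<open>auto simp: infinitesimal_generator_def intro!: derivative_eq_intros\<close>)
  then show ?thesis by (simp add: o_def)
qed

text \<open>Although \<open>s \<mapsto> T s\<close> need not be differentiable in operator norm, the product rule holds: the difference quotient
  of \<open>w\<close> converges, so the strongly continuous factor passes to the limit, and \<open>T (s - t) (w t)\<close>
  is differentiable because \<open>w t\<close> is in the domain of the generator.\<close>

lemma infinitesimal_generator_product_rule:
  assumes w: "(w has_vector_derivative w') (at t)" and gen: "(w t, y) \<in> infinitesimal_generator T"
  shows "((\<lambda>s. T (s - t) (w s)) has_vector_derivative w' + y) (at t)"
proof -
  have "((\<lambda>s. T (s - t) ((w s - w t) /\<^sub>R (s - t))) \<longlongrightarrow> T (t - t) w') (at t)"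
    using w unfolding has_vector_derivative_iff_quotient
    by (intro strongly_continuous_family_tendsto[OF group_strongly_continuous_family] tendsto_intros)
  then have "((\<lambda>s. (T (s - t) (w s - w t) - T (t - t) (w t - w t)) /\<^sub>R (s - t)) \<longlongrightarrow> w') (at t)"
    by (simp add: linear_simps[OF group_bounded_linear])
  then have "((\<lambda>s. T (s - t) (w s - w t)) has_vector_derivative w') (at t)"
    unfolding has_vector_derivative_iff_quotient .
  from has_vector_derivative_add[OF this infinitesimal_generator_shift[OF gen]]
  show ?thesis by (simp add: linear_simps[OF group_bounded_linear])
qed

lemma group_orbit_has_vector_derivative:
  assumes "(x, y) \<in> infinitesimal_generator T"
  shows "((\<lambda>s. T s x) has_vector_derivative T t y) (at t)"
  using bounded_linear.has_vector_derivative[OF group_bounded_linear infinitesimal_generator_shift[OF assms], of t t]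
  by (simp add: group_add[symmetric])

lemma group_orbit_in_generator:
  assumes "(x, y) \<in> infinitesimal_generator T"
  shows "(T t x, T t y) \<in> infinitesimal_generator T"
  using bounded_linear.has_vector_derivative[OF group_bounded_linear infinitesimal_generator_shift[OF assms, of 0], of t]
  by (simp add: infinitesimal_generator_def group_commute)

lemma subspace_infinitesimal_generator: "subspace (infinitesimal_generator T)"
  unfolding subspace_def infinitesimal_generator_def
  by (auto simp: zero_prod_def linear_simps[OF group_bounded_linear] intro!: derivative_eq_intros)

lemma strongly_continuous_group_reverse: "strongly_continuous_group (\<lambda>t. T (- t))"
  unfolding strongly_continuous_group_def
proof (intro conjI allI)
  show "continuous_on UNIV (\<lambda>t. T (- t) x)" for x
    by (intro strongly_continuous_family_continuous_on[OF group_strongly_continuous_family]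
        continuous_intros)
  show "T (- (s + t)) = T (- s) \<circ> T (- t)" for s t
    by (simp add: fun_eq_iff group_add[symmetric])
qed (simp_all add: group_bounded_linear fun_eq_iff)

lemma infinitesimal_generator_reverse:
  assumes "(x, y) \<in> infinitesimal_generator T"
  shows "(x, - y) \<in> infinitesimal_generator (\<lambda>t. T (- t))"
proof -
  have "(((\<lambda>s. T s x) \<circ> uminus) has_vector_derivative (-1) *\<^sub>R y) (at 0)"
    by (rule vector_diff_chain_at)
      (use assms in \<open>auto simp: infinitesimal_generator_def intro!: derivative_eq_intros\<close>)
  then show ?thesis by (simp add: o_def infinitesimal_generator_def)
qed

end

text \<open>The product rule for the reversed group shows that \<open>T (- t) (z t)\<close> has derivative zero.\<close>

theorem abstract_Cauchy_problem_unique: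
  fixes T :: "real \<Rightarrow> 'a::banach \<Rightarrow> 'a"
  assumes T: "strongly_continuous_group T"
    and z: "\<And>t. (z has_vector_derivative z' t) (at t)"
    and gen: "\<And>t. (z t, z' t) \<in> infinitesimal_generator T"
  shows "z t = T t (z 0)"
proof -
  note R = strongly_continuous_group_reverse[OF T]
  have "((\<lambda>s. T (- s) (z s)) has_vector_derivative 0) (at t)" for t
  proof -
    have "((\<lambda>s. T (- t) (T (- (s - t)) (z s))) has_vector_derivative T (- t) (z' t + - z' t)) (at t)"
      by (intro bounded_linear.has_vector_derivative[OF group_bounded_linear[OF T]]
          infinitesimal_generator_product_rule[OF R z] infinitesimal_generator_reverse[OF T gen])
    then show ?thesis
      by (simp add: group_add[OF T, symmetric] linear_simps[OF group_bounded_linear[OF T]])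
  qed
  then obtain c where "\<And>s. s \<in> UNIV \<Longrightarrow> T (- s) (z s) = c"
    by (rule has_vector_derivative_zero_constant[OF convex_UNIV]) auto
  then have "T (- t) (z t) = z 0"
    by (metis UNIV_I add.inverse_neutral group_zero[OF T])
  then show ?thesis by (metis group_cancel(2)[OF T])
qed

text \<open>With \<open>V t = \<integral>\<^sub>0\<^sup>t T s x ds\<close>, the curves \<open>t \<mapsto> T h (V t)\<close> and \<open>t \<mapsto> V (h + t) - V h\<close> have the same derivative and
  both vanish at \<open>0\<close>. So \<open>T h (V r) = V (r + h) - V h\<close>, which can be differentiated in \<open>h\<close>.\<close>

lemma integrated_orbit_in_generator:
  fixes T :: "real \<Rightarrow> 'a::banach \<Rightarrow> 'a"
  assumes T: "strongly_continuous_group T"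
  shows "(oriented_integral 0 r (\<lambda>s. T s x), T r x - x) \<in> infinitesimal_generator T"
proof -
  define V where "V t = oriented_integral 0 t (\<lambda>s. T s x)" for t
  have V: "(V has_vector_derivative T t x) (at t)" for t
    unfolding V_def using T
    by (intro oriented_integral_has_vector_derivative) (auto simp: strongly_continuous_group_def)
  have V0: "V 0 = 0" by (simp add: V_def oriented_integral_def)
  have Vs: "((\<lambda>s. V (r + s)) has_vector_derivative T (r + t) x) (at t)" for r t
  proof -
    have "((V \<circ> (\<lambda>s. r + s)) has_vector_derivative 1 *\<^sub>R T (r + t) x) (at t)"
      by (rule vector_diff_chain_at) (auto intro!: derivative_eq_intros V)
    then show ?thesis by (simp add: o_def)
  qed
  have shift: "T h (V r) = V (r + h) - V h" for h
  proof -
    have "((\<lambda>s. T h (V s) - V (h + s)) has_vector_derivative T h (T t x) - T (h + t) x) (at t)" for t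
      by (intro has_vector_derivative_diff bounded_linear.has_vector_derivative[OF group_bounded_linear[OF T]] V Vs)
    then have "((\<lambda>s. T h (V s) - V (h + s)) has_vector_derivative 0) (at t)" for t
      by (simp add: group_add[OF T])
    then obtain c where c: "\<And>s. s \<in> UNIV \<Longrightarrow> T h (V s) - V (h + s) = c"
      by (rule has_vector_derivative_zero_constant[OF convex_UNIV]) auto
    have "T h (V r) - V (h + r) = T h (V 0) - V (h + 0)" using c[OF UNIV_I] by metis
    then show ?thesis by (simp add: V0 linear_simps[OF group_bounded_linear[OF T]] algebra_simps)
  qed
  have "((\<lambda>h. V (r + h) - V h) has_vector_derivative T (r + 0) x - T 0 x) (at 0)"
    by (intro has_vector_derivative_diff Vs V)
  then have "((\<lambda>h. T h (V r)) has_vector_derivative T r x - x) (at 0)"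
    by (simp add: shift group_zero[OF T])
  then show ?thesis by (simp add: infinitesimal_generator_def V_def)
qed

text \<open>The averages \<open>(1/r) \<integral>\<^sub>0\<^sup>r T s x ds\<close> lie in the domain and tend to \<open>x\<close>.\<close>

theorem infinitesimal_generator_densely_defined:
  fixes T :: "real \<Rightarrow> 'a::banach \<Rightarrow> 'a"
  assumes T: "strongly_continuous_group T"
  shows "closure (Domain (infinitesimal_generator T)) = UNIV"
proof -
  have "x \<in> closure (Domain (infinitesimal_generator T))" for x
  proof -
    have "((\<lambda>r. oriented_integral 0 r (\<lambda>s. T s x)) has_vector_derivative T 0 x) (at 0)"
      using T by (intro oriented_integral_has_vector_derivative) (auto simp: strongly_continuous_group_def)
    then have "((\<lambda>r. oriented_integral 0 r (\<lambda>s. T s x) /\<^sub>R r) \<longlongrightarrow> x) (at 0)"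
      by (simp add: has_vector_derivative_iff_quotient group_zero[OF T] oriented_integral_def)
    moreover have "oriented_integral 0 r (\<lambda>s. T s x) /\<^sub>R r \<in> closure (Domain (infinitesimal_generator T))" for r
    proof -
      have "inverse r *\<^sub>R (oriented_integral 0 r (\<lambda>s. T s x), T r x - x) \<in> infinitesimal_generator T"
        by (intro subspace_scale[OF subspace_infinitesimal_generator[OF T]] integrated_orbit_in_generator[OF T])
      then show ?thesis by (intro subsetD[OF closure_subset]) (auto intro: DomainI)
    qed
    ultimately show ?thesis
      by (intro Lim_in_closed_set[OF closed_closure always_eventually trivial_limit_at]) auto
  qed
  then show ?thesis by blast
qed

text \<open>Choose \<open>\<mu>\<close> so large that the rescaled group \<open>U t = exp (- \<mu> * t) T t\<close> has \<open>norm (U 1) \<le> 1/2\<close>. Then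
  \<open>x - U 1 x = r\<close> is solvable by contraction, and \<open>V = \<integral>\<^sub>0\<^sup>1 U s x ds\<close> satisfies \<open>(\<mu> - G) V = x - U 1 x = r\<close>
  for the generator \<open>G\<close> of \<open>T\<close>. Integrating over the unit interval only avoids the improper integral of the
  Laplace transform. An eigenvector \<open>y\<close> for \<open>\<mu>\<close> would satisfy \<open>U 1 y = y\<close>.\<close>

theorem infinitesimal_generator_resolvent_point:
  fixes T :: "real \<Rightarrow> 'a::banach \<Rightarrow> 'a"
  assumes T: "strongly_continuous_group T"
  obtains \<mu> :: real where "\<And>r. \<exists>y g. (y, g) \<in> infinitesimal_generator T \<and> \<mu> *\<^sub>R y - g = r"
    "\<And>y. (y, \<mu> *\<^sub>R y) \<in> infinitesimal_generator T \<Longrightarrow> y = 0"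
proof -
  obtain K where K: "K > 0" "\<And>x. norm (T 1 x) \<le> norm x * K"
    using bounded_linear.pos_bounded[OF group_bounded_linear[OF T, of 1]] by blast
  \<comment> \<open>This gives \<open>exp (- \<mu>) * K = 1/2\<close>.\<close>
  define \<mu> where "\<mu> = ln (2 * K)"
  define U where "U t x = exp (- \<mu> * t) *\<^sub>R T t x" for t x
  have U: "strongly_continuous_group U"
    unfolding strongly_continuous_group_def
  proof (intro conjI allI)
    show "bounded_linear (U t)" for t
      unfolding U_def by (intro bounded_linear_const_scaleR group_bounded_linear[OF T])
    show "U 0 = id" by (simp add: U_def fun_eq_iff group_zero[OF T])
    show "U (s + t) = U s \<circ> U t" for s t
    proof -
      have "exp (- \<mu> * (s + t)) = exp (- \<mu> * s) * exp (- \<mu> * t)"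
        by (simp add: algebra_simps flip: exp_add)
      then show ?thesis
        by (simp add: U_def fun_eq_iff group_add[OF T] linear_simps[OF group_bounded_linear[OF T]])
    qed
    show "continuous_on UNIV (\<lambda>t. U t x)" for x
      unfolding U_def using T
      by (intro continuous_intros) (simp add: strongly_continuous_group_def)
  qed
  have U_gen: "(x, y + \<mu> *\<^sub>R x) \<in> infinitesimal_generator T"
    if "(x, y) \<in> infinitesimal_generator U" for x y
  proof -
    have "((\<lambda>t. exp (\<mu> * t) *\<^sub>R U t x) has_vector_derivative exp (\<mu> * 0) *\<^sub>R y + \<mu> *\<^sub>R U 0 x) (at 0)"
      using that unfolding infinitesimal_generator_def
      by (intro has_vector_derivative_scaleR) (auto intro!: derivative_eq_intros)
    moreover have "exp (\<mu> * t) *\<^sub>R U t x = T t x" for t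
      by (simp add: U_def flip: exp_add)
    ultimately have "((\<lambda>t. T t x) has_vector_derivative exp (\<mu> * 0) *\<^sub>R y + \<mu> *\<^sub>R U 0 x) (at 0)"
      by (simp only:)
    then show ?thesis
      by (simp only: infinitesimal_generator_def group_zero[OF U] mem_Collect_eq prod.case
          mult_zero_right exp_zero scaleR_one)
  qed
  have half: "norm (U 1 x) \<le> 1/2 * norm x" for x
  proof -
    have e: "exp (- \<mu> * 1) = inverse (2 * K)"
      using K(1) unfolding \<mu>_def mult_1_right exp_minus by (subst exp_ln) auto
    have "norm (U 1 x) = exp (- \<mu> * 1) * norm (T 1 x)"
      unfolding U_def norm_scaleR abs_exp_cancel ..
    also have "\<dots> \<le> inverse (2 * K) * (norm x * K)"
      unfolding e using K by (intro mult_left_mono) auto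
    also have "\<dots> = 1/2 * norm x" using K(1) by (simp add: field_simps)
    finally show ?thesis .
  qed
  show ?thesis
  proof (rule that[of \<mu>])
    fix r
    have "\<exists>!x. r + U 1 x = x"
    proof (rule banach_fix_type[where c = "1/2"])
      show "\<forall>x y. dist (r + U 1 x) (r + U 1 y) \<le> 1/2 * dist x y"
        using half by (simp add: dist_norm flip: linear_simps(2)[OF group_bounded_linear[OF U]])
    qed auto
    then obtain x where x: "x - U 1 x = r" by (metis add_diff_cancel_right')
    let ?V = "oriented_integral 0 1 (\<lambda>s. U s x)"
    have "(?V, U 1 x - x + \<mu> *\<^sub>R ?V) \<in> infinitesimal_generator T"
      by (intro U_gen integrated_orbit_in_generator[OF U])
    moreover have "\<mu> *\<^sub>R ?V - (U 1 x - x + \<mu> *\<^sub>R ?V) = r" using x by simp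
    ultimately show "\<exists>y g. (y, g) \<in> infinitesimal_generator T \<and> \<mu> *\<^sub>R y - g = r" by blast
  next
    fix y assume y: "(y, \<mu> *\<^sub>R y) \<in> infinitesimal_generator T"
    have "((\<lambda>t. exp (\<mu> * t) *\<^sub>R y) has_vector_derivative \<mu> *\<^sub>R exp (\<mu> * t) *\<^sub>R y) (at t)" for t
    proof -
      have "((\<lambda>t. exp (\<mu> * t) *\<^sub>R y) has_vector_derivative exp (\<mu> * t) *\<^sub>R 0 + (\<mu> * exp (\<mu> * t)) *\<^sub>R y) (at t)"
        by (rule has_vector_derivative_scaleR) (auto intro!: derivative_eq_intros)
      then show ?thesis by simp
    qed
    moreover have "(exp (\<mu> * t) *\<^sub>R y, \<mu> *\<^sub>R exp (\<mu> * t) *\<^sub>R y) \<in> infinitesimal_generator T" for t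
      using subspace_scale[OF subspace_infinitesimal_generator[OF T] y, of "exp (\<mu> * t)"]
      by (simp add: mult.commute)
    ultimately have "exp (\<mu> * 1) *\<^sub>R y = T 1 (exp (\<mu> * 0) *\<^sub>R y)"
      by (rule abstract_Cauchy_problem_unique[OF T])
    then have "T 1 y = exp \<mu> *\<^sub>R y" by simp
    then have "U 1 y = y" by (simp add: U_def flip: exp_add)
    then show "y = 0" using half[of y] by simp
  qed
qed

text \<open>The substitution \<open>z t = T t (y t)\<close> turns the perturbed equation into \<open>y' = Q t y\<close> with the bounded operators
  \<open>Q t = T (- t) P (T t)\<close>. If \<open>Y x\<close> is the solution starting at \<open>x\<close>, then \<open>S t x = T t (Y x t)\<close> is the perturbed
  group. The group law follows from uniqueness, because \<open>T t (Q (t + r) v) = Q r (T t v)\<close>. As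
  \<open>Y x\<close> is differentiable at \<open>0\<close> with derivative \<open>P x\<close> for every \<open>x\<close>, an orbit of \<open>S\<close> is differentiable at
  \<open>0\<close> exactly if that of \<open>T\<close> is, and the derivatives differ by \<open>P x\<close>.\<close>

theorem bounded_perturbation_of_group:
  fixes T :: "real \<Rightarrow> 'a::banach \<Rightarrow> 'a"
  assumes T: "strongly_continuous_group T" and P: "bounded_linear P"
  obtains S where "strongly_continuous_group S"
    "\<And>x y. (x, y) \<in> infinitesimal_generator S \<longleftrightarrow> (x, y - P x) \<in> infinitesimal_generator T"
proof -
  note lin = group_bounded_linear[OF T] and fam = group_strongly_continuous_family[OF T]
  define Q where "Q t x = T (- t) (P (T t x))" for t x
  have Q: "strongly_continuous_family Q"
    unfolding strongly_continuous_family_def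
  proof (intro conjI allI)
    show "bounded_linear (Q t)" for t
      unfolding Q_def by (intro bounded_linear_compose[OF lin] bounded_linear_compose[OF P] lin)
    show "continuous_on UNIV (\<lambda>t. Q t x)" for x
      unfolding Q_def
      by (intro strongly_continuous_family_continuous_on[OF fam] bounded_linear.continuous_on[OF P]
          continuous_intros)
  qed
  have "\<forall>x. \<exists>y. y 0 = x \<and> (\<forall>t. (y has_vector_derivative Q t (y t)) (at t)) \<and>
      (\<forall>t. \<forall>K\<ge>0. (\<forall>s v. \<bar>s\<bar> \<le> \<bar>t\<bar> \<longrightarrow> norm (Q s v) \<le> K * norm v) \<longrightarrow>
        norm (y t) \<le> exp (K * \<bar>t\<bar>) * norm x)"
  proof
    fix x
    show "\<exists>y. y 0 = x \<and> (\<forall>t. (y has_vector_derivative Q t (y t)) (at t)) \<and>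
      (\<forall>t. \<forall>K\<ge>0. (\<forall>s v. \<bar>s\<bar> \<le> \<bar>t\<bar> \<longrightarrow> norm (Q s v) \<le> K * norm v) \<longrightarrow>
        norm (y t) \<le> exp (K * \<bar>t\<bar>) * norm x)"
      by (rule linear_ode_solvable[OF Q, of x]) blast
  qed
  then obtain Y where Y0: "\<And>x. Y x 0 = x"
    and Yd: "\<And>x t. (Y x has_vector_derivative Q t (Y x t)) (at t)"
    and Yb: "\<And>x t K. K \<ge> 0 \<Longrightarrow> (\<And>s v. \<bar>s\<bar> \<le> \<bar>t\<bar> \<Longrightarrow> norm (Q s v) \<le> K * norm v) \<Longrightarrow>
        norm (Y x t) \<le> exp (K * \<bar>t\<bar>) * norm x"
    by metis
  have Qlin: "bounded_linear (Q t)" for t using Q by (simp add: strongly_continuous_family_def)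
  have Yuniq: "Y (y 0) = y" if "\<And>t. (y has_vector_derivative Q t (y t)) (at t)" for y
    by (rule linear_ode_unique[OF Q Yd that]) (simp add: Y0)
  have Ylin: "bounded_linear (\<lambda>x. Y x t)" for t
  proof -
    obtain K where K: "K \<ge> 0" "\<And>s v. \<bar>s\<bar> \<le> \<bar>t\<bar> \<Longrightarrow> norm (Q s v) \<le> K * norm v"
      using strongly_continuous_family_bounded_on_compact[OF Q] by blast
    show ?thesis
    proof (rule bounded_linear_intro[where K = "exp (K * \<bar>t\<bar>)"])
      show "Y (x + y) t = Y x t + Y y t" for x y
        using Yuniq[of "\<lambda>t. Y x t + Y y t"]
        by (simp add: Y0 linear_simps[OF Qlin] has_vector_derivative_add Yd)
      show "Y (c *\<^sub>R x) t = c *\<^sub>R Y x t" for c x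
        using Yuniq[of "\<lambda>t. c *\<^sub>R Y x t"]
        by (simp add: Y0 linear_simps[OF Qlin] bounded_linear.has_vector_derivative[OF bounded_linear_scaleR_right] Yd)
      show "norm (Y x t) \<le> norm x * exp (K * \<bar>t\<bar>)" for x
        using Yb[OF K] by (simp add: mult.commute)
    qed
  qed
  define S where "S t x = T t (Y x t)" for t x
  have S: "strongly_continuous_group S"
    unfolding strongly_continuous_group_def
  proof (intro conjI allI)
    show "bounded_linear (S t)" for t
      unfolding S_def by (rule bounded_linear_compose[OF lin Ylin])
    show "S 0 = id" by (simp add: S_def fun_eq_iff group_zero[OF T] Y0)
    show "continuous_on UNIV (\<lambda>t. S t x)" for x
      unfolding S_def
      by (intro strongly_continuous_family_continuous_on[OF fam] continuous_on_id
          continuous_at_imp_continuous_on ballI has_vector_derivative_continuous[OF Yd])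
    show "S (s + t) = S s \<circ> S t" for s t
    proof
      fix x
      have "((\<lambda>r. T t (Y x (t + r))) has_vector_derivative Q r (T t (Y x (t + r)))) (at r)" for r
      proof -
        have "((Y x \<circ> (\<lambda>r. t + r)) has_vector_derivative 1 *\<^sub>R Q (t + r) (Y x (t + r))) (at r)"
          by (rule vector_diff_chain_at) (auto intro!: derivative_eq_intros Yd)
        then have "((\<lambda>r. T t (Y x (t + r))) has_vector_derivative T t (Q (t + r) (Y x (t + r)))) (at r)"
          by (intro bounded_linear.has_vector_derivative[OF lin]) (simp add: o_def)
        moreover have "T t (Q (t + r) v) = Q r (T t v)" for v
          by (simp add: Q_def group_add[OF T, symmetric] add.commute)
        ultimately show ?thesis by simp
      qed
      from Yuniq[of "\<lambda>r. T t (Y x (t + r))", OF this]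
      have "Y (S t x) = (\<lambda>r. T t (Y x (t + r)))" by (simp add: S_def)
      then show "S (s + t) x = (S s \<circ> S t) x"
        by (simp add: S_def group_add[OF T, symmetric] add.commute)
    qed
  qed
  have "(x, y) \<in> infinitesimal_generator S \<longleftrightarrow> (x, y - P x) \<in> infinitesimal_generator T" for x y
  proof
    have Yx: "(Y x has_vector_derivative P x) (at 0)"
      using Yd[of x 0] by (simp add: Q_def Y0 group_zero[OF T])
    {
      assume "(x, y - P x) \<in> infinitesimal_generator T"
      then show "(x, y) \<in> infinitesimal_generator S"
        using infinitesimal_generator_product_rule[OF T Yx, of "y - P x"] Y0
        by (simp add: S_def infinitesimal_generator_def)
    next
      assume x: "(x, y) \<in> infinitesimal_generator S"
      have "((\<lambda>s. Y x s - x) has_vector_derivative P x - 0) (at 0)"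
        by (intro has_vector_derivative_diff Yx has_vector_derivative_const)
      then have "((\<lambda>s. T (s - 0) (Y x s - x)) has_vector_derivative P x - 0 + 0) (at 0)"
        by (rule infinitesimal_generator_product_rule[OF T])
          (use subspace_0[OF subspace_infinitesimal_generator[OF T]] in \<open>simp add: Y0 zero_prod_def\<close>)
      then have "((\<lambda>s. S s x - T s (Y x s - x)) has_vector_derivative y - P x) (at 0)"
        using x by (intro has_vector_derivative_diff) (simp_all add: infinitesimal_generator_def)
      then show "(x, y - P x) \<in> infinitesimal_generator T"
        by (simp add: infinitesimal_generator_def S_def linear_simps[OF lin])
    }
  qed
  with S show ?thesis by (rule that)
qed

section \<open>The wave equation with acoustic boundary conditions\<close>

lemma has_vector_derivative_Pair_iff:
  "(f has_vector_derivative (a, b)) (at t within S) \<longleftrightarrow>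
    ((\<lambda>t. fst (f t)) has_vector_derivative a) (at t within S) \<and> ((\<lambda>t. snd (f t)) has_vector_derivative b) (at t within S)"
  using bounded_linear.has_vector_derivative[OF bounded_linear_fst, of f "(a, b)" "at t within S"]
    bounded_linear.has_vector_derivative[OF bounded_linear_snd, of f "(a, b)" "at t within S"]
    has_vector_derivative_Pair[of "\<lambda>t. fst (f t)" a t S "\<lambda>t. snd (f t)" b]
  by auto

lemma group_extended_by_identity:
  fixes T :: "real \<Rightarrow> 'a::banach \<Rightarrow> 'a"
  assumes T: "strongly_continuous_group T"
  defines "U \<equiv> \<lambda>t (p, q :: 'c::banach). (T t p, q)"
  shows "strongly_continuous_group U"
    "((p, q), (p', q')) \<in> infinitesimal_generator U \<longleftrightarrow> (p, p') \<in> infinitesimal_generator T \<and> q' = 0"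
proof -
  have U: "U t z = (T t (fst z), snd z)" for t z by (simp add: U_def split_beta)
  show "strongly_continuous_group U"
    unfolding strongly_continuous_group_def
  proof (intro conjI allI)
    show "bounded_linear (U t)" for t
      unfolding U by (intro bounded_linear_Pair bounded_linear_compose[OF group_bounded_linear[OF T]]
          bounded_linear_fst bounded_linear_snd)
    show "continuous_on UNIV (\<lambda>t. U t z)" for z
      unfolding U using T by (intro continuous_intros) (simp add: strongly_continuous_group_def)
  qed (simp_all add: fun_eq_iff U group_zero[OF T] group_add[OF T])
  show "((p, q), (p', q')) \<in> infinitesimal_generator U \<longleftrightarrow> (p, p') \<in> infinitesimal_generator T \<and> q' = 0"
  proof -
    have "((\<lambda>t. q) has_vector_derivative q') (at 0) \<longleftrightarrow> q' = 0"
      using vector_derivative_unique_at has_vector_derivative_const by blast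
    then show ?thesis
      by (simp add: infinitesimal_generator_def has_vector_derivative_Pair_iff U)
  qed
qed

text \<open>Transfers the generation result through the changes of variables in the state space.\<close>

lemma group_conjugated_by_isomorphism:
  fixes T :: "real \<Rightarrow> 'a::banach \<Rightarrow> 'a" and \<Phi> :: "'c::banach \<Rightarrow> 'a"
  assumes T: "strongly_continuous_group T"
    and \<Phi>: "bounded_linear \<Phi>" and \<Psi>: "bounded_linear \<Psi>"
    and inverse: "\<And>z. \<Psi> (\<Phi> z) = z" "\<And>z. \<Phi> (\<Psi> z) = z"
  defines "U \<equiv> \<lambda>t z. \<Psi> (T t (\<Phi> z))"
  shows "strongly_continuous_group U"
    "(z, z') \<in> infinitesimal_generator U \<longleftrightarrow> (\<Phi> z, \<Phi> z') \<in> infinitesimal_generator T"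
proof -
  show "strongly_continuous_group U"
    unfolding strongly_continuous_group_def
  proof (intro conjI allI)
    show "bounded_linear (U t)" for t
      unfolding U_def
      by (intro bounded_linear_compose[OF \<Psi>] bounded_linear_compose[OF group_bounded_linear[OF T]] \<Phi>)
    show "continuous_on UNIV (\<lambda>t. U t z)" for z
      unfolding U_def using T
      by (intro bounded_linear.continuous_on[OF \<Psi>]) (simp add: strongly_continuous_group_def)
  qed (simp_all add: fun_eq_iff U_def group_zero[OF T] group_add[OF T] inverse)
  show "(z, z') \<in> infinitesimal_generator U \<longleftrightarrow> (\<Phi> z, \<Phi> z') \<in> infinitesimal_generator T"
    unfolding infinitesimal_generator_def U_def
    using bounded_linear.has_vector_derivative[OF \<Psi>, of "\<lambda>t. T t (\<Phi> z)" "\<Phi> z'" "at 0"]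
      bounded_linear.has_vector_derivative[OF \<Phi>, of "\<lambda>t. \<Psi> (T t (\<Phi> z))" z' "at 0"]
    by (auto simp: inverse)
qed

lemma linear_operator_subspace: "linear_operator D T \<Longrightarrow> subspace D"
  and linear_operator_add: "linear_operator D T \<Longrightarrow> u \<in> D \<Longrightarrow> v \<in> D \<Longrightarrow> T (u + v) = T u + T v"
  and linear_operator_scale: "linear_operator D T \<Longrightarrow> u \<in> D \<Longrightarrow> T (c *\<^sub>R u) = c *\<^sub>R T u"
  by (auto simp: linear_operator_def)

lemma linear_operator_diff:
  assumes "linear_operator D T" "u \<in> D" "v \<in> D"
  shows "T (u - v) = T u - T v"
  using linear_operator_add[OF assms(1), of u "(-1) *\<^sub>R v"] linear_operator_scale[OF assms(1,3), of "-1"]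
    subspace_neg[OF linear_operator_subspace[OF assms(1)] assms(3)] assms(2)
  by simp

text \<open>
  The boundary operator \<open>R\<close>, whose kernel carries the wave group, is the \<open>R\<^sup>\<diamond> = L - B2\<^sup>\<diamond>\<close> of the
  problem, and \<open>C1\<close> to \<open>C4\<close> are the coefficients \<open>B1\<^sup>\<diamond>\<close> to \<open>B4\<^sup>\<diamond>\<close> of the boundary equation, so
  that \<open>L = R + C2\<close>.
\<close>

locale acoustic_boundary_system =
  fixes \<iota> :: "'y::banach \<Rightarrow> 'x::banach"
    and DA :: "'y set" and A :: "'y \<Rightarrow> 'x" and R :: "'y \<Rightarrow> 'b::banach"
    and C1 C2 :: "'y \<Rightarrow> 'b" and C3 C4 :: "'b \<Rightarrow> 'b"
  assumes embedding: "bounded_linear \<iota>" "inj \<iota>"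
    and A: "linear_operator DA A"
    and R: "linear_operator DA R"
    and C: "bounded_linear C1" "bounded_linear C2" "bounded_linear C3" "bounded_linear C4"
    and AR_closed: "closed_operator DA (\<lambda>u. (A u, R u))"
    and R_surj: "R ` DA = UNIV"
    and cosine: "generates_cosine_with_phase_space \<iota> {u \<in> DA. R u = 0} A"
begin

lemma homogeneous_wave_group:
  obtains T where "strongly_continuous_group T"
    "\<And>u v p q. ((u, v), (p, q)) \<in> infinitesimal_generator T \<longleftrightarrow>
      u \<in> DA \<and> R u = 0 \<and> v = \<iota> p \<and> q = A u"
proof -
  obtain T where T: "strongly_continuous_group T"
    and gen: "infinitesimal_generator T =
      operator_graph ({u \<in> DA. R u = 0} \<times> range \<iota>) (\<lambda>(u, v). (inv \<iota> v, A u))"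
    using cosine unfolding generates_cosine_with_phase_space_def generates_group_iff by blast
  have "((u, v), (p, q)) \<in> infinitesimal_generator T \<longleftrightarrow> u \<in> DA \<and> R u = 0 \<and> v = \<iota> p \<and> q = A u"
    for u v p q
    unfolding gen operator_graph_def using embedding(2) by auto
  with T show ?thesis by (rule that)
qed

text \<open>Given \<open>w\<close>, correct any \<open>u1\<close> with \<open>R u1 = w\<close> by the element \<open>u0\<close> of the kernel of \<open>R\<close> with
  \<open>\<kappa> u0 - A u0 = A u1 - \<kappa> u1\<close>. It is the first component of a resolvent of the wave group: for
  \<open>\<kappa> = \<mu>\<^sup>2\<close>, the equation \<open>(\<mu> - G) (u0, v) = (0, r)\<close> says \<open>v = \<mu> u0\<close> and \<open>\<kappa> u0 - A u0 = r\<close>. Injectivity of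
  \<open>\<mu> - G\<close> makes the solution of \<open>A u = \<kappa> u\<close>, \<open>R u = w\<close> unique, hence linear in \<open>w\<close>, and closedness of \<open>(A, R)\<close> is
  closedness of its graph.\<close>

lemma Dirichlet_operator:
  obtains E \<kappa> where "bounded_linear E"
    "\<And>w. E w \<in> DA" "\<And>w. R (E w) = w" "\<And>w. A (E w) = \<kappa> *\<^sub>R \<iota> (E w)"
proof -
  note \<iota> = linear_simps[OF embedding(1)]
  obtain T where T: "strongly_continuous_group T"
    and gen: "\<And>u v p q. ((u, v), (p, q)) \<in> infinitesimal_generator T \<longleftrightarrow>
      u \<in> DA \<and> R u = 0 \<and> v = \<iota> p \<and> q = A u"
    using homogeneous_wave_group by blast
  obtain \<mu> :: real where \<mu>: "\<And>r. \<exists>y g. (y, g) \<in> infinitesimal_generator T \<and> \<mu> *\<^sub>R y - g = r"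
      "\<And>y. (y, \<mu> *\<^sub>R y) \<in> infinitesimal_generator T \<Longrightarrow> y = 0"
    using infinitesimal_generator_resolvent_point[OF T] by blast
  define \<kappa> where "\<kappa> = \<mu> * \<mu>"
  have sub: "subspace DA" using A by (rule linear_operator_subspace)
  have kernel: "d = 0" if d: "d \<in> DA" "R d = 0" "A d = \<kappa> *\<^sub>R \<iota> d" for d
  proof -
    have "((d, \<mu> *\<^sub>R \<iota> d), \<mu> *\<^sub>R (d, \<mu> *\<^sub>R \<iota> d)) \<in> infinitesimal_generator T"
      using d by (simp add: gen \<iota> \<kappa>_def)
    from \<mu>(2)[OF this] show ?thesis by (simp add: zero_prod_def)
  qed
  have ex: "\<exists>u\<in>DA. R u = w \<and> A u = \<kappa> *\<^sub>R \<iota> u" for w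
  proof -
    obtain u1 where u1: "u1 \<in> DA" "R u1 = w" using R_surj by (metis UNIV_I imageE)
    obtain y g where yg: "(y, g) \<in> infinitesimal_generator T" "\<mu> *\<^sub>R y - g = (0, A u1 - \<kappa> *\<^sub>R \<iota> u1)"
      using \<mu>(1) by blast
    obtain u0 v p q where "y = (u0, v)" "g = (p, q)" by fastforce
    with yg have u0: "u0 \<in> DA" "R u0 = 0" "\<kappa> *\<^sub>R \<iota> u0 - A u0 = A u1 - \<kappa> *\<^sub>R \<iota> u1"
      by (auto simp: gen \<kappa>_def \<iota>)
    have "A (u1 + u0) = \<kappa> *\<^sub>R \<iota> (u1 + u0)"
      using u0(3) unfolding linear_operator_add[OF A u1(1) u0(1)] \<iota> scaleR_add_right
      by (simp add: algebra_simps)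
    moreover have "R (u1 + u0) = w"
      by (simp add: linear_operator_add[OF R u1(1) u0(1)] u1 u0)
    ultimately show ?thesis using subspace_add[OF sub u1(1) u0(1)] by blast
  qed
  have unique: "u = u'"
    if "u \<in> DA" "R u = w" "A u = \<kappa> *\<^sub>R \<iota> u" "u' \<in> DA" "R u' = w" "A u' = \<kappa> *\<^sub>R \<iota> u'" for u u' w
  proof -
    have "u - u' = 0"
      using that by (intro kernel subspace_diff[OF sub])
        (simp_all add: linear_operator_diff[OF A] linear_operator_diff[OF R] \<iota> scaleR_diff_right)
    then show ?thesis by simp
  qed
  obtain E where E: "\<And>w. E w \<in> DA" "\<And>w. R (E w) = w" "\<And>w. A (E w) = \<kappa> *\<^sub>R \<iota> (E w)"
    using ex by metis
  have "linear E"
  proof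
    show "E (v + w) = E v + E w" for v w
      by (rule unique[OF E])
        (simp_all add: E subspace_add[OF sub] linear_operator_add[OF A] linear_operator_add[OF R] \<iota>
          scaleR_add_right)
    show "E (c *\<^sub>R w) = c *\<^sub>R E w" for c w
      by (rule unique[OF E])
        (simp_all add: E subspace_scale[OF sub] linear_operator_scale[OF A] linear_operator_scale[OF R] \<iota>)
  qed
  have "bounded_linear E"
  proof (rule closed_graph_theorem[OF \<open>linear E\<close>])
    fix f w u assume f: "f \<longlonglongrightarrow> w" and u: "(\<lambda>n. E (f n)) \<longlonglongrightarrow> u"
    have "(\<lambda>n. (E (f n), (A (E (f n)), R (E (f n))))) \<longlonglongrightarrow> (u, (\<kappa> *\<^sub>R \<iota> u, w))"
      unfolding E by (intro tendsto_intros bounded_linear.tendsto[OF embedding(1)] f u)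
    then have "(u, (\<kappa> *\<^sub>R \<iota> u, w)) \<in> operator_graph DA (\<lambda>u. (A u, R u))"
      by (rule closed_sequentially[OF AR_closed[unfolded closed_operator_def], rotated])
        (auto simp: operator_graph_def E)
    then show "E w = u"
      by (intro unique[OF E]) (auto simp: operator_graph_def)
  qed
  from that[OF this E] show ?thesis .
qed

definition L :: "'y \<Rightarrow> 'b" where "L u = R u + C2 u"

text \<open>The operator matrix of the problem, with the coupling \<open>y = L u\<close> in its domain, generates a group.
  In the coordinates \<open>((u - E w, v), (x, w))\<close> with \<open>w = y - C2 u\<close> it is the sum of the wave operator, extended by
  zero, and a bounded operator.\<close>

theorem acoustic_group:
  obtains W where "strongly_continuous_group W"
    "\<And>u v x y u' v' x' y'. ((u, v, x, y), (u', v', x', y')) \<in> infinitesimal_generator W \<longleftrightarrow>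
      u \<in> DA \<and> y = L u \<and> v = \<iota> u' \<and> v' = A u \<and> x' = L u \<and>
      y' = C1 u + C2 u' + C3 x + C4 y"
proof -
  obtain T where T: "strongly_continuous_group T"
    and genT: "\<And>u v p q. ((u, v), (p, q)) \<in> infinitesimal_generator T \<longleftrightarrow>
      u \<in> DA \<and> R u = 0 \<and> v = \<iota> p \<and> q = A u"
    using homogeneous_wave_group by blast
  obtain E \<kappa> where E: "bounded_linear E"
    "\<And>w. E w \<in> DA" "\<And>w. R (E w) = w" "\<And>w. A (E w) = \<kappa> *\<^sub>R \<iota> (E w)"
    using Dirichlet_operator by blast
  have sub: "subspace DA" using A by (rule linear_operator_subspace)
  define U where "U = (\<lambda>t (p, q :: 'b \<times> 'b). (T t p, q))"
  have U: "strongly_continuous_group U"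
    and genU: "\<And>p q p' q'. ((p, q), (p', q')) \<in> infinitesimal_generator U \<longleftrightarrow>
      (p, p') \<in> infinitesimal_generator T \<and> q' = 0"
    unfolding U_def by (rule group_extended_by_identity[OF T])+
  \<comment> \<open>\<open>N u x y\<close> is the derivative of \<open>w = y - C2 u\<close>; the velocity of \<open>u\<close> has cancelled.\<close>
  define N where "N u x y = C1 u + C3 x + C4 y" for u x y
  define P where "P z = (let u = fst (fst z) + E (snd (snd z)); x = fst (snd z); w = snd (snd z);
      y = w + C2 u in ((- E (N u x y), \<kappa> *\<^sub>R \<iota> (E w)), (y, N u x y)))" for z :: "('y \<times> 'x) \<times> ('b \<times> 'b)"
  have P_eq: "P ((u0, v), (x, w)) = ((- E (N (u0 + E w) x (w + C2 (u0 + E w))), \<kappa> *\<^sub>R \<iota> (E w)),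
      (w + C2 (u0 + E w), N (u0 + E w) x (w + C2 (u0 + E w))))" for u0 v x w
    by (simp add: P_def Let_def)
  note bl = bounded_linear_Pair bounded_linear_add bounded_linear_sub bounded_linear_minus
    bounded_linear_const_scaleR bounded_linear_fst bounded_linear_snd bounded_linear_ident
    bounded_linear_compose[OF bounded_linear_fst] bounded_linear_compose[OF bounded_linear_snd]
    bounded_linear_compose[OF E(1)] bounded_linear_compose[OF embedding(1)]
    bounded_linear_compose[OF C(1)] bounded_linear_compose[OF C(2)]
    bounded_linear_compose[OF C(3)] bounded_linear_compose[OF C(4)]
  have "bounded_linear P"
    unfolding P_def Let_def N_def by (intro bl)
  then obtain S where S: "strongly_continuous_group S"
    and genS: "\<And>z z'. (z, z') \<in> infinitesimal_generator S \<longleftrightarrow> (z, z' - P z) \<in> infinitesimal_generator U"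
    using bounded_perturbation_of_group[OF U] by blast
  define \<Phi> where "\<Phi> s = (let u = fst s; v = fst (snd s); x = fst (snd (snd s)); w = snd (snd (snd s)) - C2 u
      in ((u - E w, v), (x, w)))" for s :: "'y \<times> 'x \<times> 'b \<times> 'b"
  define \<Psi> where "\<Psi> z = (let u = fst (fst z) + E (snd (snd z))
      in (u, snd (fst z), fst (snd z), snd (snd z) + C2 u))" for z :: "('y \<times> 'x) \<times> ('b \<times> 'b)"
  have \<Phi>_eq: "\<Phi> (u, v, x, y) = ((u - E (y - C2 u), v), (x, y - C2 u))" for u v x y
    by (simp add: \<Phi>_def Let_def)
  define W where "W = (\<lambda>t z. \<Psi> (S t (\<Phi> z)))"
  have "bounded_linear \<Phi>" unfolding \<Phi>_def Let_def by (intro bl)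
  moreover have "bounded_linear \<Psi>" unfolding \<Psi>_def Let_def by (intro bl)
  moreover have "\<Psi> (\<Phi> z) = z" for z by (simp add: \<Phi>_def \<Psi>_def Let_def)
  moreover have "\<Phi> (\<Psi> z) = z" for z by (simp add: \<Phi>_def \<Psi>_def Let_def)
  ultimately have W: "strongly_continuous_group W"
    and genW: "\<And>z z'. (z, z') \<in> infinitesimal_generator W \<longleftrightarrow> (\<Phi> z, \<Phi> z') \<in> infinitesimal_generator S"
    unfolding W_def by (rule group_conjugated_by_isomorphism[OF S])+
  have "((u, v, x, y), (u', v', x', y')) \<in> infinitesimal_generator W \<longleftrightarrow>
      u \<in> DA \<and> y = L u \<and> v = \<iota> u' \<and> v' = A u \<and> x' = L u \<and> y' = C1 u + C2 u' + C3 x + C4 y"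
    for u v x y u' v' x' y'
  proof -
    define w w' where "w = y - C2 u" and "w' = y' - C2 u'"
    have y: "y = w + C2 u" by (simp add: w_def)
    have "((u, v, x, y), (u', v', x', y')) \<in> infinitesimal_generator W \<longleftrightarrow>
        ((u - E w, v), (u' - E w' + E (N u x y), v' - \<kappa> *\<^sub>R \<iota> (E w))) \<in> infinitesimal_generator T \<and>
        x' = y \<and> w' = N u x y"
      unfolding genW genS \<Phi>_eq w_def[symmetric] w'_def[symmetric] P_eq
      by (auto simp: genU zero_prod_def y)
    also have "\<dots> \<longleftrightarrow> (u - E w \<in> DA \<and> R (u - E w) = 0) \<and> v = \<iota> u' \<and> v' - \<kappa> *\<^sub>R \<iota> (E w) = A (u - E w) \<and>
        x' = y \<and> w' = N u x y"
      by (auto simp: genT)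
    also have "u - E w \<in> DA \<and> R (u - E w) = 0 \<longleftrightarrow> u \<in> DA \<and> R u = w"
    proof -
      have "u - E w \<in> DA \<longleftrightarrow> u \<in> DA"
        using subspace_diff[OF sub _ E(2)] subspace_add[OF sub _ E(2), of "u - E w" w] by auto
      then show ?thesis using linear_operator_diff[OF R _ E(2), of u w] E(3) by auto
    qed
    also have "(u \<in> DA \<and> R u = w) \<and> v = \<iota> u' \<and> v' - \<kappa> *\<^sub>R \<iota> (E w) = A (u - E w) \<and> x' = y \<and> w' = N u x y
        \<longleftrightarrow> (u \<in> DA \<and> R u = w) \<and> v = \<iota> u' \<and> v' = A u \<and> x' = y \<and> w' = N u x y"
      using linear_operator_diff[OF A _ E(2), of u w] E(4) by auto
    also have "\<dots> \<longleftrightarrow> u \<in> DA \<and> y = L u \<and> v = \<iota> u' \<and> v' = A u \<and> x' = L u \<and>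
        y' = C1 u + C2 u' + C3 x + C4 y"
      by (auto simp: L_def w_def w'_def N_def algebra_simps)
    finally show ?thesis .
  qed
  with W show ?thesis by (rule that)
qed

text \<open>The state of a classical solution is a differentiable curve in the domain of the generator that solves
  the first order equation, hence an orbit of \<open>W\<close>. Conversely the first component of an orbit starting in
  the domain is a classical solution, since such orbits are continuously differentiable in
  \<open>Y \<times> X \<times> \<partial>X \<times> \<partial>X\<close>. The admissible initial data form exactly the domain of the generator.\<close>

theorem acoustic_system_well_posed: "well_posed \<iota> DA A L C1 C2 C3 C4"
proof -
  obtain W where W: "strongly_continuous_group W"
    and gen: "\<And>u v x y u' v' x' y'. ((u, v, x, y), (u', v', x', y')) \<in> infinitesimal_generator W \<longleftrightarrow>
      u \<in> DA \<and> y = L u \<and> v = \<iota> u' \<and> v' = A u \<and> x' = L u \<and>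
      y' = C1 u + C2 u' + C3 x + C4 y"
    using acoustic_group by blast
  let ?sol = "classical_solution \<iota> DA A L C1 C2 C3 C4"
  have orbit: "solution_state \<iota> L h u t = W t (f, \<iota> g, h, L f)"
    if "?sol f g h (L f) u" for f g h u t
  proof -
    define u' where "u' t = vector_derivative u (at t)" for t
    define x where "x = boundary_component L u h"
    define x' where "x' t = vector_derivative x (at t)" for t
    have u_C1: "u C1_differentiable_on UNIV"
      and uD: "\<And>t. u t \<in> DA"
      and u2: "\<And>t. ((\<lambda>s. vector_derivative (\<iota> \<circ> u) (at s)) has_vector_derivative A (u t)) (at t)"
      and x2: "\<And>t. (x' has_vector_derivative C1 (u t) + C2 (u' t) + C3 (x t) + C4 (x' t)) (at t)"
      and x1: "\<And>t. (x has_vector_derivative L (u t)) (at t)"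
      and init: "u 0 = f" "u' 0 = g" "x 0 = h" "x' 0 = L f"
      using that unfolding classical_solution_def Let_def u'_def x_def x'_def by blast+
    have u1: "(u has_vector_derivative u' t) (at t)" for t
      using u_C1 unfolding u'_def C1_differentiable_on_eq by (simp flip: vector_derivative_works)
    have "vector_derivative (\<iota> \<circ> u) (at t) = \<iota> (u' t)" for t
      unfolding o_def
      by (intro vector_derivative_at bounded_linear.has_vector_derivative[OF embedding(1)] u1)
    with u2 have v: "((\<lambda>t. \<iota> (u' t)) has_vector_derivative A (u t)) (at t)" for t by simp
    have x'L: "x' t = L (u t)" for t unfolding x'_def by (rule vector_derivative_at[OF x1])
    have state: "solution_state \<iota> L h u = (\<lambda>t. (u t, \<iota> (u' t), x t, x' t))"
      by (simp add: fun_eq_iff solution_state_def u'_def x_def x'_def)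
    have "solution_state \<iota> L h u t = W t (solution_state \<iota> L h u 0)"
      unfolding state
      by (rule abstract_Cauchy_problem_unique[OF W, where
            z' = "\<lambda>t. (u' t, A (u t), L (u t), C1 (u t) + C2 (u' t) + C3 (x t) + C4 (x' t))"])
        (intro has_vector_derivative_Pair u1 v x1 x2, simp add: gen uD x'L)
    then show ?thesis by (simp add: state init)
  qed
  have exists: "\<exists>u. ?sol f g h (L f) u" if f: "f \<in> DA" for f g and h :: 'b
  proof -
    define z0 where "z0 = (f, \<iota> g, h, L f)"
    define z1 where "z1 = (g, A f, L f, C1 f + C2 g + C3 h + C4 (L f))"
    have z01: "(z0, z1) \<in> infinitesimal_generator W" by (simp add: z0_def z1_def gen f)
    define u v x y where "u t = fst (W t z0)" and "v t = fst (snd (W t z0))"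
      and "x t = fst (snd (snd (W t z0)))" and "y t = snd (snd (snd (W t z0)))" for t
    define u' v' x' y' where "u' t = fst (W t z1)" and "v' t = fst (snd (W t z1))"
      and "x' t = fst (snd (snd (W t z1)))" and "y' t = snd (snd (snd (W t z1)))" for t
    have Wz0: "W t z0 = (u t, v t, x t, y t)" and Wz1: "W t z1 = (u' t, v' t, x' t, y' t)" for t
      by (simp_all add: u_def v_def x_def y_def u'_def v'_def x'_def y'_def)
    have eqs: "u t \<in> DA" "y t = L (u t)" "v t = \<iota> (u' t)" "v' t = A (u t)" "x' t = L (u t)"
      "y' t = C1 (u t) + C2 (u' t) + C3 (x t) + C4 (y t)" for t
      using group_orbit_in_generator[OF W z01, of t] unfolding Wz0 Wz1 gen by blast+
    have "((\<lambda>t. W t z0) has_vector_derivative W t z1) (at t)" for t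
      by (rule group_orbit_has_vector_derivative[OF W z01])
    then have d: "(u has_vector_derivative u' t) (at t)" "(v has_vector_derivative v' t) (at t)"
        "(x has_vector_derivative x' t) (at t)" "(y has_vector_derivative y' t) (at t)" for t
      unfolding Wz1 has_vector_derivative_Pair_iff u_def v_def x_def y_def by blast+
    have "continuous_on UNIV (\<lambda>t. W t z1)"
      using W unfolding strongly_continuous_group_def by blast
    then have c: "continuous_on UNIV u'" "continuous_on UNIV v'" "continuous_on UNIV y'"
      unfolding u'_def v'_def y'_def by (intro continuous_intros; assumption)+
    have init: "u 0 = f" "u' 0 = g" "x 0 = h" "y 0 = L f"
      by (simp_all add: u_def u'_def x_def y_def group_zero[OF W] z0_def z1_def)
    have vd_u: "vector_derivative u (at t) = u' t" for t by (rule vector_derivative_at[OF d(1)])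
    have d_iu: "((\<iota> \<circ> u) has_vector_derivative v t) (at t)" for t
      unfolding o_def eqs by (rule bounded_linear.has_vector_derivative[OF embedding(1) d(1)])
    have vd_iu: "(\<lambda>t. vector_derivative (\<iota> \<circ> u) (at t)) = v"
      by (rule ext, rule vector_derivative_at[OF d_iu])
    have yL: "(\<lambda>t. L (u t)) = y" by (simp add: fun_eq_iff eqs)
    have v_cont: "continuous_on UNIV v" and y_cont: "continuous_on UNIV y"
      by (intro continuous_at_imp_continuous_on ballI has_vector_derivative_continuous[OF d(2)]
          has_vector_derivative_continuous[OF d(4)])+
    \<comment> \<open>The boundary component of a solution is defined as an integral and has to be recognised in the orbit.\<close>
    have bc: "boundary_component L u h = x"
    proof
      fix t
      have "x t = x 0 + oriented_integral 0 t y"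
        by (rule oriented_integral_eq_antiderivative[OF y_cont]) (use d(3) eqs in simp)
      then show "boundary_component L u h t = x t"
        by (simp add: boundary_component_def yL init)
    qed
    have dx: "(x has_vector_derivative y t) (at t)" for t using d(3) eqs by simp
    have vd_x: "vector_derivative x (at t) = y t" for t by (rule vector_derivative_at[OF dx])
    have "C2_on_line (\<iota> \<circ> u)"
      unfolding C2_on_line_def vd_iu C1_differentiable_on_def using d_iu d(2) v_cont c(2) by blast
    moreover have "u C1_differentiable_on UNIV" "y C1_differentiable_on UNIV"
      unfolding C1_differentiable_on_def using d c by blast+
    ultimately have "?sol f g h (L f) u"
      unfolding classical_solution_def Let_def bc vd_iu vd_u vd_x yL
      using eqs d(2,4) dx init by simp
    then show ?thesis by blast
  qed
  show ?thesis
    unfolding well_posed_def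
  proof (intro conjI ballI allI impI)
    fix f g h assume f: "f \<in> DA"
    show "\<exists>!u. ?sol f g h (L f) u"
    proof (rule ex_ex1I[OF exists[OF f]])
      fix u1 u2 assume "?sol f g h (L f) u1" "?sol f g h (L f) u2"
      then have "solution_state \<iota> L h u1 t = solution_state \<iota> L h u2 t" for t by (simp add: orbit)
      then show "u1 = u2" by (simp add: fun_eq_iff solution_state_def)
    qed
  next
    have "Domain (infinitesimal_generator W) = {(f, \<iota> g, h, L f) | f g h. f \<in> DA}"
    proof (intro equalityI subsetI)
      fix z assume "z \<in> Domain (infinitesimal_generator W)"
      then obtain z' where "(z, z') \<in> infinitesimal_generator W" by blast
      then show "z \<in> {(f, \<iota> g, h, L f) | f g h. f \<in> DA}"
        by (cases z; cases z') (auto simp: gen)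
    next
      fix z assume "z \<in> {(f, \<iota> g, h :: 'b, L f) | f g h. f \<in> DA}"
      then obtain f g and h :: 'b where "z = (f, \<iota> g, h, L f)" "f \<in> DA" by blast
      then have "(z, (g, A f, L f, C1 f + C2 g + C3 h + C4 (L f))) \<in> infinitesimal_generator W"
        by (simp add: gen)
      then show "z \<in> Domain (infinitesimal_generator W)" by blast
    qed
    then show "closure {(f, \<iota> g, h :: 'b, L f) | f g h. f \<in> DA} = UNIV"
      using infinitesimal_generator_densely_defined[OF W] by simp
  next
    fix a b f g h u and \<epsilon> :: real
    assume f: "f \<in> DA" and u: "?sol f g h (L f) u" and \<epsilon>: "\<epsilon> > 0"
    obtain K where K: "K \<ge> 0" "\<And>t z. \<bar>t\<bar> \<le> max \<bar>a\<bar> \<bar>b\<bar> \<Longrightarrow> norm (W t z) \<le> K * norm z"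
      using strongly_continuous_family_bounded_on_compact[OF group_strongly_continuous_family[OF W]]
      by blast
    show "\<exists>\<delta>>0. \<forall>f2\<in>DA. \<forall>g2 h2 u2. ?sol f2 g2 h2 (L f2) u2 \<longrightarrow>
        dist (f2, \<iota> g2, h2, L f2) (f, \<iota> g, h, L f) < \<delta> \<longrightarrow>
        (\<forall>t\<in>{a..b}. dist (solution_state \<iota> L h2 u2 t) (solution_state \<iota> L h u t) < \<epsilon>)"
    proof (intro exI[of _ "\<epsilon> / (K + 1)"] conjI ballI allI impI)
      show "0 < \<epsilon> / (K + 1)" using K(1) \<epsilon> by simp
      fix f2 g2 h2 u2 t
      assume u2: "?sol f2 g2 h2 (L f2) u2" and t: "t \<in> {a..b}"
        and close: "dist (f2, \<iota> g2, h2, L f2) (f, \<iota> g, h, L f) < \<epsilon> / (K + 1)"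
      let ?d = "(f2, \<iota> g2, h2, L f2) - (f, \<iota> g, h, L f)"
      have "dist (solution_state \<iota> L h2 u2 t) (solution_state \<iota> L h u t) = norm (W t ?d)"
        unfolding orbit[OF u] orbit[OF u2] dist_norm linear_simps(2)[OF group_bounded_linear[OF W]] ..
      also have "\<dots> \<le> K * norm ?d" using t by (intro K(2)) auto
      also have "\<dots> \<le> (K + 1) * norm ?d" by (simp add: mult_right_mono)
      also have "\<dots> < \<epsilon>"
        using close K(1) unfolding dist_norm by (simp add: field_simps)
      finally show "dist (solution_state \<iota> L h2 u2 t) (solution_state \<iota> L h u t) < \<epsilon>" .
    qed
  qed
qed

end

theorem proposition5p3:
  fixes \<iota> :: "'y::banach \<Rightarrow> 'x::banach"
    and DA :: "'y set" and A :: "'y \<Rightarrow> 'x" and R :: "'y \<Rightarrow> 'b::banach"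
    and B1 B2 :: "'y \<Rightarrow> 'b" and B3 B4 :: "'b \<Rightarrow> 'b"
    and DM :: "'b set" and M :: "'b \<Rightarrow> 'b"
    and L Rd :: "'y \<Rightarrow> 'b" and B1d B2d :: "'y \<Rightarrow> 'b" and B3d B4d :: "'b \<Rightarrow> 'b"
  assumes embedding: "bounded_linear \<iota>" "inj \<iota>"
    and A: "linear_operator DA A"
    and R: "linear_operator DA R"
    and B: "bounded_linear B1" "bounded_linear B2" "bounded_linear B3" "bounded_linear B4"
    and L: "L = (\<lambda>u. R u + B2 u)"
    and AR_closed: "closed_operator DA (\<lambda>u. (A u, R u))"
    and M: "linear_operator DM M" "closed_operator DM M" "1 \<in> resolvent_set DM M"
    and Bd: "B1d = resolvent DM M 1 \<circ> B1" "B2d = resolvent DM M 1 \<circ> B2"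
            "B3d = resolvent DM M 1 \<circ> B3" "B4d = resolvent DM M 1 \<circ> B4"
    and Rd: "Rd = (\<lambda>u. L u - B2d u)"
    and Rd_surj: "Rd ` DA = UNIV"
    and cosine: "generates_cosine_with_phase_space \<iota> {u \<in> DA. Rd u = 0} A"
  shows "well_posed \<iota> DA A L B1d B2d B3d B4d"
proof -
  have "bounded_linear (resolvent DM M 1)" using M(3) by (simp add: resolvent_set_def)
  then have Bd_bounded: "bounded_linear B1d" "bounded_linear B2d" "bounded_linear B3d" "bounded_linear B4d"
    unfolding Bd o_def by (simp_all add: bounded_linear_compose B)
  \<comment> \<open>\<open>Rd\<close> differs from \<open>R\<close> by the bounded operator \<open>K\<close>, so \<open>(A, Rd)\<close> inherits closedness from \<open>(A, R)\<close>.\<close>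
  define K where "K u = B2 u - B2d u" for u
  have K: "bounded_linear K" unfolding K_def by (intro bounded_linear_sub B Bd_bounded)
  have Rd_eq: "Rd u = R u + K u" for u by (simp add: Rd L K_def)
  have Rd_lin: "linear_operator DA Rd"
    using R unfolding linear_operator_def Rd_eq by (simp add: linear_simps[OF K] algebra_simps)
  have ARd_closed: "closed_operator DA (\<lambda>u. (A u, Rd u))"
    unfolding closed_operator_def closed_sequential_limits
  proof (intro allI impI, elim conjE)
    fix s l assume s: "\<forall>n. s n \<in> operator_graph DA (\<lambda>u. (A u, Rd u))" and lim: "s \<longlonglongrightarrow> l"
    obtain u p q where l: "l = (u, p, q)" by (cases l)
    obtain v where v: "\<And>n. v n \<in> DA" "\<And>n. s n = (v n, A (v n), Rd (v n))"
      using s unfolding operator_graph_def image_iff by metis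
    have "(\<lambda>n. fst (s n)) \<longlonglongrightarrow> u" "(\<lambda>n. fst (snd (s n))) \<longlonglongrightarrow> p" "(\<lambda>n. snd (snd (s n))) \<longlonglongrightarrow> q"
      using tendsto_fst[OF lim] tendsto_fst[OF tendsto_snd[OF lim]] tendsto_snd[OF tendsto_snd[OF lim]]
      by (simp_all add: l)
    then have "v \<longlonglongrightarrow> u" "(\<lambda>n. A (v n)) \<longlonglongrightarrow> p" "(\<lambda>n. Rd (v n)) \<longlonglongrightarrow> q" by (simp_all add: v)
    then have "(\<lambda>n. (v n, A (v n), Rd (v n) - K (v n))) \<longlonglongrightarrow> (u, p, q - K u)"
      by (intro tendsto_intros bounded_linear.tendsto[OF K])
    then have "(u, p, q - K u) \<in> operator_graph DA (\<lambda>u. (A u, R u))"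
      by (rule closed_sequentially[OF AR_closed[unfolded closed_operator_def], rotated])
        (auto simp: operator_graph_def Rd_eq v)
    then have "u \<in> DA" "p = A u" "q = Rd u" by (auto simp: operator_graph_def Rd_eq diff_eq_eq)
    then show "l \<in> operator_graph DA (\<lambda>u. (A u, Rd u))"
      by (simp add: operator_graph_def l)
  qed
  interpret S: acoustic_boundary_system \<iota> DA A Rd B1d B2d B3d B4d
    by (intro acoustic_boundary_system.intro embedding A Rd_lin Bd_bounded ARd_closed Rd_surj cosine)
  have "S.L = L"
    by (rule ext, unfold S.L_def) (simp add: Rd)
  with S.acoustic_system_well_posed show ?thesis by (simp only:)
qed

end
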